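(* For every integer $n\ge 0$, the following congruences hold: \begin{align*} p_{3,3}(12n+6)\equiv p_{3,3}(12n+9)&\equiv 0 \pmod{2},\\ p_{3,3}(6n+4)&\equiv 0 \pmod{4},\\ p_{3,3}(3n+1)&\equiv 0 \pmod{3},\\ p_{3,3}(3n+2)&\equiv 0 \pmod{9},\\ p_{3,3}(9n+5)\equiv p_{3,3}(9n+8)&\equiv 0 \pmod{27},\\ p_{3,3}(5n+3)&\equiv 0 \pmod{5}. \end{align*}
   Context: For $|q|<1$ let $(a;q)_\infty:=\prod_{k\ge 0}(1-aq^k)$. The function $p_{3,3}(n)$ (the number of $2$-color partition triples of $n$ where one of the colors appears only in parts that are multiples of $3$) is defined for integers $n\ge 0$ by the generating function $$\sum_{n\ge 0}p_{3,3}(n)q^n:=\frac{1}{(q;q)_\infty^3(q^3;q^3)_\infty^3}.$$ *)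

theory Defs
  imports "HOL-Complex_Analysis.Complex_Analysis" "HOL-Number_Theory.Cong"
begin

definition qpoch :: "complex \<Rightarrow> complex \<Rightarrow> complex" where
  "qpoch a q = (\<Prod>k. 1 - a * q ^ k)"

(* The integer sequence with the given generating function on the unit disc.  Existence and
   uniqueness of such a sequence, which the definite description relies on, are proved below
   (p33_sums and p33_unique). *)
definition p33 :: "nat \<Rightarrow> nat" where
  "p33 = (THE p. \<forall>q::complex. norm q < 1 \<longrightarrow>
            (\<lambda>n. of_nat (p n) * q ^ n) sums (1 / (qpoch q q ^ 3 * qpoch (q ^ 3) (q ^ 3) ^ 3)))"

definition nat_series :: "(nat \<Rightarrow> nat) \<Rightarrow> (complex \<Rightarrow> complex) \<Rightarrow> bool" where
  "nat_series a f \<longleftrightarrow> (\<forall>q. norm q < 1 \<longrightarrow> (\<lambda>n. of_nat (a n) * q ^ n) sums f q)"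

lemma nat_series_holomorphic:
  assumes "nat_series a f"
  shows "f holomorphic_on ball 0 1"
  using assms by (intro power_series_holomorphic[where a = "\<lambda>n. of_nat (a n)"])
    (auto simp: nat_series_def)

lemma nat_series_coeff:
  assumes "nat_series a f"
  shows "of_nat (a n) = (deriv ^^ n) f 0 / fact n"
proof -
  have "eventually (\<lambda>u::complex. u \<in> ball 0 1) (nhds 0)"
    by (intro eventually_nhds_in_open) auto
  hence "f has_fps_expansion Abs_fps (\<lambda>n. of_nat (a n))"
    by (intro has_fps_expansionI, elim eventually_mono) (use assms in \<open>auto simp: nat_series_def\<close>)
  from fps_nth_fps_expansion[OF this, of n] show ?thesis by simp
qed

lemma nat_series_unique:
  assumes "nat_series a f" "nat_series b f"
  shows "a = b"
proof
  fix n
  have "(of_nat (a n) :: complex) = of_nat (b n)"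
    using nat_series_coeff[OF assms(1)] nat_series_coeff[OF assms(2)] by metis
  thus "a n = b n" by simp
qed

lemma nat_series_1: "\<exists>a. nat_series a (\<lambda>_. 1)"
proof
  show "nat_series (\<lambda>n. if n = 0 then 1 else 0) (\<lambda>_. 1)"
    unfolding nat_series_def
  proof (intro allI impI)
    fix q :: complex
    have "(\<lambda>n. if n = 0 then q ^ n else 0) sums q ^ 0"
      by (rule sums_single)
    moreover have "(\<lambda>n. of_nat (if n = 0 then 1 else 0) * q ^ n) = (\<lambda>n. if n = 0 then q ^ n else 0)"
      by auto
    ultimately show "(\<lambda>n. of_nat (if n = 0 then 1 else 0) * q ^ n) sums 1" by simp
  qed
qed

lemma nat_series_summable_norm:
  fixes q :: complex
  assumes "nat_series a f" "norm q < 1"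
  shows "summable (\<lambda>n. norm (of_nat (a n) * q ^ n))"
proof -
  define x where "x = complex_of_real ((1 + norm q) / 2)"
  have nx: "norm x = (1 + norm q) / 2"
    unfolding x_def norm_of_real by (rule abs_of_nonneg) simp
  have "norm x < 1" using assms(2) nx by simp
  hence "summable (\<lambda>n. of_nat (a n) * x ^ n)"
    using assms(1) unfolding nat_series_def by (blast intro: sums_summable)
  thus ?thesis
    by (rule powser_insidea) (use assms nx in auto)
qed

lemma nat_series_mult:
  assumes "\<exists>a. nat_series a f" "\<exists>b. nat_series b g"
  shows "\<exists>c. nat_series c (\<lambda>q. f q * g q)"
proof -
  obtain a b where a: "nat_series a f" and b: "nat_series b g" using assms by blast
  have "nat_series (\<lambda>n. \<Sum>i\<le>n. a i * b (n - i)) (\<lambda>q. f q * g q)"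
    unfolding nat_series_def
  proof (intro allI impI)
    fix q :: complex assume q: "norm q < 1"
    have eq: "(\<Sum>i\<le>n. of_nat (a i) * q ^ i * (of_nat (b (n - i)) * q ^ (n - i))) =
                of_nat (\<Sum>i\<le>n. a i * b (n - i)) * q ^ n" for n
    proof -
      have "of_nat (a i) * q ^ i * (of_nat (b (n - i)) * q ^ (n - i)) =
              of_nat (a i * b (n - i)) * q ^ n" if "i \<le> n" for i
        using that power_add[of q i "n - i"] by simp
      thus ?thesis unfolding of_nat_sum sum_distrib_right by (intro sum.cong) auto
    qed
    have "(\<Sum>k. of_nat (a k) * q ^ k) = f q" "(\<Sum>k. of_nat (b k) * q ^ k) = g q"
      using a b q by (auto simp: nat_series_def sums_iff)
    thus "(\<lambda>n. of_nat (\<Sum>i\<le>n. a i * b (n - i)) * q ^ n) sums (f q * g q)"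
      using Cauchy_product_sums[OF nat_series_summable_norm[OF a q] nat_series_summable_norm[OF b q]]
      by (simp only: eq)
  qed
  thus ?thesis by blast
qed

lemma nat_series_prod:
  fixes N :: nat
  assumes "\<And>k. \<exists>a. nat_series a (f k)"
  shows "\<exists>a. nat_series a (\<lambda>q. \<Prod>k<N. f k q)"
proof (induction N)
  case 0
  show ?case using nat_series_1 by simp
next
  case (Suc N)
  show ?case using nat_series_mult[OF Suc.IH assms[of N]] by simp
qed

lemma nat_series_power:
  assumes "\<exists>a. nat_series a f"
  shows "\<exists>a. nat_series a (\<lambda>q. f q ^ N)"
  using nat_series_prod[of "\<lambda>_. f" N] assms by simp

lemma nat_series_geometric:
  assumes m: "m > 0"
  shows "\<exists>a. nat_series a (\<lambda>q. inverse (1 - q ^ m))"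
proof
  show "nat_series (\<lambda>n. if m dvd n then 1 else 0) (\<lambda>q. inverse (1 - q ^ m))"
    unfolding nat_series_def
  proof (intro allI impI)
    fix q :: complex assume q: "norm q < 1"
    have "norm (q ^ m) < 1"
      using q m by (simp add: norm_power power_less_one_iff)
    hence "(\<lambda>k. (q ^ m) ^ k) sums (1 / (1 - q ^ m))"
      by (rule geometric_sums)
    hence "(\<lambda>k. of_nat (if m dvd m * k then 1 else 0) * q ^ (m * k)) sums inverse (1 - q ^ m)"
      by (simp add: inverse_eq_divide flip: power_mult)
    thus "(\<lambda>n. of_nat (if m dvd n then 1 else 0) * q ^ n) sums inverse (1 - q ^ m)"
      by (subst (asm) sums_mono_reindex) (use m in \<open>auto simp: strict_mono_def\<close>)
  qed
qed

lemma nat_series_limit: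
  assumes f: "\<And>N::nat. \<exists>a. nat_series a (f N)"
  assumes lim: "\<And>r. 0 < r \<Longrightarrow> r < 1 \<Longrightarrow> uniform_limit (cball 0 r) f g sequentially"
  shows "\<exists>a. nat_series a g"
proof -
  obtain a where a: "nat_series (a N) (f N)" for N using f by metis
  have hol: "f N holomorphic_on ball 0 1" for N using a nat_series_holomorphic by blast
  have g: "g holomorphic_on ball 0 1"
  proof (rule holomorphic_uniform_sequence[OF open_ball hol])
    fix x :: complex assume x: "x \<in> ball 0 1"
    define d where "d = (1 - norm x) / 2"
    have "norm x < 1" using x by simp
    hence d: "d > 0" "norm x + d < 1" by (simp_all add: d_def field_simps)
    hence d': "0 < norm x + d" by (simp add: add_nonneg_pos)
    have sub: "cball x d \<subseteq> cball 0 (norm x + d)"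
    proof
      fix y assume "y \<in> cball x d"
      hence "norm (x - y) \<le> d" by (simp add: dist_norm)
      moreover have "norm y \<le> norm x + norm (y - x)" by (rule norm_triangle_sub)
      ultimately show "y \<in> cball 0 (norm x + d)" by (simp add: norm_minus_commute)
    qed
    moreover have "cball 0 (norm x + d) \<subseteq> ball (0::complex) 1" using d(2) by auto
    ultimately have "cball x d \<subseteq> ball 0 1" by (rule order_trans)
    thus "\<exists>d. 0 < d \<and> cball x d \<subseteq> ball 0 1 \<and> uniform_limit (cball x d) f g sequentially"
      using d(1) uniform_limit_on_subset[OF lim[OF d' d(2)] sub] by (intro exI[of _ d] conjI)
  qed
  have "(deriv ^^ n) g 0 / fact n \<in> \<nat>" for n
  proof (rule closed_sequentially[OF closed_Nats])
    have "uniform_limit (ball 0 (1/2)) f g sequentially"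
      by (rule uniform_limit_on_subset[OF lim[of "1/2"]]) auto
    hence "(\<lambda>N. (deriv ^^ n) (f N) 0) \<longlonglongrightarrow> (deriv ^^ n) g 0"
      by (rule higher_deriv_complex_uniform_limit)
         (auto intro!: always_eventually holomorphic_on_subset[OF hol])
    thus "(\<lambda>N. (deriv ^^ n) (f N) 0 / fact n) \<longlonglongrightarrow> (deriv ^^ n) g 0 / fact n"
      by (intro tendsto_intros) auto
    show "(deriv ^^ n) (f N) 0 / fact n \<in> \<nat>" for N
      unfolding nat_series_coeff[OF a[of N], of n, symmetric] by (rule of_nat_in_Nats)
  qed
  hence "\<forall>n. \<exists>c. (deriv ^^ n) g 0 / fact n = of_nat c"
    by (auto elim: Nats_cases)
  then obtain c where c: "(deriv ^^ n) g 0 / fact n = of_nat (c n)" for n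
    by (auto dest: choice)
  have "nat_series c g"
    unfolding nat_series_def
  proof (intro allI impI)
    fix q :: complex assume "norm q < 1"
    hence "(\<lambda>n. (deriv ^^ n) g 0 / fact n * (q - 0) ^ n) sums g q"
      by (intro holomorphic_power_series[OF g]) auto
    thus "(\<lambda>n. of_nat (c n) * q ^ n) sums g q" by (simp only: c diff_0_right)
  qed
  thus ?thesis by blast
qed

lemma convergent_prod_qpoch:
  fixes a q :: complex
  assumes "norm q < 1"
  shows "convergent_prod (\<lambda>k. 1 - a * q ^ k)"
proof -
  have "summable (\<lambda>k. norm a * norm q ^ k)"
    using assms by (intro summable_mult summable_geometric) auto
  thus ?thesis
    by (intro abs_convergent_prod_imp_convergent_prod summable_imp_abs_convergent_prod)
       (simp add: norm_mult norm_power)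
qed

lemma qpoch_power_nonzero:
  assumes "norm q < 1" "m > 0"
  shows "qpoch (q ^ m) (q ^ m) \<noteq> 0"
proof -
  have 1: "norm (q ^ m) < 1"
    using assms by (simp add: norm_power power_less_one_iff)
  have "1 - q ^ m * (q ^ m) ^ k \<noteq> 0" for k
  proof
    assume "1 - q ^ m * (q ^ m) ^ k = 0"
    hence "norm ((q ^ m) ^ Suc k) = 1" by simp
    moreover have "norm ((q ^ m) ^ Suc k) < 1"
      using power_less_one_iff[of "norm (q ^ m)" "Suc k"] 1 by (simp only: norm_power) simp
    ultimately show False by simp
  qed
  thus ?thesis
    unfolding qpoch_def by (intro prodinf_nonzero convergent_prod_qpoch 1)
qed

lemma uniform_limit_qpoch:
  assumes m: "m > 0" and r: "0 < r" "r < 1"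
  shows "uniform_limit (cball 0 r) (\<lambda>N q. \<Prod>k<N. 1 - q ^ m * (q ^ m) ^ k)
           (\<lambda>q. qpoch (q ^ m) (q ^ m)) sequentially"
proof -
  have "uniformly_convergent_on (cball 0 r) (\<lambda>N q::complex. \<Prod>k<N. 1 - q ^ m * (q ^ m) ^ k)"
  proof (rule uniformly_convergent_on_prod')
    show "uniformly_convergent_on (cball 0 r)
            (\<lambda>N q::complex. \<Sum>k<N. norm (1 - q ^ m * (q ^ m) ^ k - 1))"
    proof (rule Weierstrass_m_test')
      show "summable (\<lambda>k. r ^ k)" using r by (intro summable_geometric) auto
      fix k and q :: complex assume q: "q \<in> cball 0 r"
      have "norm q ^ (m + m * k) \<le> norm q ^ k"
        using q r m by (intro power_decreasing) (auto simp: trans_le_add2)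
      also have "\<dots> \<le> r ^ k" using q by (intro power_mono) auto
      finally show "norm (norm (1 - q ^ m * (q ^ m) ^ k - 1)) \<le> r ^ k"
        by (simp add: norm_mult norm_power power_add power_mult)
    qed
  qed (auto intro!: continuous_intros)
  then obtain l where l: "uniform_limit (cball 0 r)
      (\<lambda>N q::complex. \<Prod>k<N. 1 - q ^ m * (q ^ m) ^ k) l sequentially"
    unfolding uniformly_convergent_on_def by blast
  have "l q = qpoch (q ^ m) (q ^ m)" if q: "q \<in> cball 0 r" for q
  proof -
    have "norm (q ^ m) < 1" using q r m by (simp add: norm_power power_less_one_iff)
    hence "(\<lambda>N. \<Prod>k\<le>N. 1 - q ^ m * (q ^ m) ^ k) \<longlonglongrightarrow> qpoch (q ^ m) (q ^ m)"
      unfolding qpoch_def by (intro convergent_prod_LIMSEQ convergent_prod_qpoch)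
    hence "(\<lambda>N. \<Prod>k<N. 1 - q ^ m * (q ^ m) ^ k) \<longlonglongrightarrow> qpoch (q ^ m) (q ^ m)"
      by (simp add: LIMSEQ_lessThan_iff_atMost)
    thus ?thesis using tendsto_uniform_limitI[OF l q] LIMSEQ_unique by blast
  qed
  thus ?thesis using l by (subst uniform_limit_cong'[where g = "\<lambda>N q. \<Prod>k<N. 1 - q ^ m * (q ^ m) ^ k" and i = l]) auto
qed

lemma nat_series_inverse_qpoch:
  assumes m: "m > 0"
  shows "\<exists>a. nat_series a (\<lambda>q. inverse (qpoch (q ^ m) (q ^ m)))"
proof (rule nat_series_limit)
  fix N :: nat
  have "\<exists>a. nat_series a (\<lambda>q. \<Prod>k<N. inverse (1 - q ^ (m + m * k)))"
    using m by (intro nat_series_prod nat_series_geometric) auto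
  moreover have "(\<Prod>k<N. inverse (1 - q ^ (m + m * k))) =
                   inverse (\<Prod>k<N. 1 - q ^ m * (q ^ m) ^ k)" for q :: complex
    unfolding prod_inversef[symmetric] o_def by (simp only: power_add power_mult)
  ultimately show "\<exists>a. nat_series a (\<lambda>q. inverse (\<Prod>k<N. 1 - q ^ m * (q ^ m) ^ k))"
    by simp
next
  fix r :: real assume r: "0 < r" "r < 1"
  let ?l = "\<lambda>q. qpoch (q ^ m) (q ^ m)"
  let ?f = "\<lambda>N q::complex. \<Prod>k<N. 1 - q ^ m * (q ^ m) ^ k"
  note ul = uniform_limit_qpoch[OF m r]
  have "continuous_on (cball 0 r) ?l"
    by (rule uniform_limit_theorem[OF _ ul]) (auto intro!: always_eventually continuous_intros)
  hence "continuous_on (cball 0 r) (\<lambda>q. norm (?l q))" by (intro continuous_intros)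
  moreover have "cball (0::complex) r \<noteq> {}" using r by simp
  ultimately obtain q0 where q0: "q0 \<in> cball 0 r" "\<And>q. q \<in> cball 0 r \<Longrightarrow> norm (?l q0) \<le> norm (?l q)"
    using continuous_attains_inf[OF compact_cball] by blast
  have "norm (?l q0) > 0" using qpoch_power_nonzero[of q0 m] q0(1) r m by simp
  from uniform_lim_inverse[OF ul q0(2) this]
  show "uniform_limit (cball 0 r) (\<lambda>N q. inverse (?f N q)) (\<lambda>q. inverse (?l q)) sequentially"
    by (simp add: o_def)
qed

lemma p33_ex1:
  "\<exists>!p::nat \<Rightarrow> nat. \<forall>q::complex. norm q < 1 \<longrightarrow>
      (\<lambda>n. of_nat (p n) * q ^ n) sums (1 / (qpoch q q ^ 3 * qpoch (q ^ 3) (q ^ 3) ^ 3))"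
proof -
  have "\<exists>a. nat_series a (\<lambda>q. inverse (qpoch (q ^ 1) (q ^ 1)) ^ 3 * inverse (qpoch (q ^ 3) (q ^ 3)) ^ 3)"
    by (intro nat_series_mult nat_series_power nat_series_inverse_qpoch) auto
  hence "\<exists>a. nat_series a (\<lambda>q. 1 / (qpoch q q ^ 3 * qpoch (q ^ 3) (q ^ 3) ^ 3))"
    by (simp add: field_simps)
  hence "\<exists>!a. nat_series a (\<lambda>q. 1 / (qpoch q q ^ 3 * qpoch (q ^ 3) (q ^ 3) ^ 3))"
    using nat_series_unique by blast
  thus ?thesis by (simp add: nat_series_def)
qed

theorem p33_sums:
  fixes q :: complex
  assumes "norm q < 1"
  shows "(\<lambda>n. of_nat (p33 n) * q ^ n) sums (1 / (qpoch q q ^ 3 * qpoch (q ^ 3) (q ^ 3) ^ 3))"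
  using theI'[OF p33_ex1] assms unfolding p33_def by blast

theorem p33_unique:
  fixes p :: "nat \<Rightarrow> nat"
  assumes "\<And>q::complex. norm q < 1 \<Longrightarrow>
    (\<lambda>n. of_nat (p n) * q ^ n) sums (1 / (qpoch q q ^ 3 * qpoch (q ^ 3) (q ^ 3) ^ 3))"
  shows "p = p33"
  using p33_ex1 assms p33_sums by blast

end

theory Submission
  imports Defs
begin

text \<open>
  Write \<open>E\<close> for Euler's product \<open>(1 - q)(1 - q^2)(1 - q^3)...\<close> and \<open>E\<^sub>k\<close> for \<open>E\<close> at \<open>q^k\<close>.  Everything takes
  place in the ring of formal power series over the integers, where the series \<open>P\<close> with
  coefficients \<open>p33 n\<close> is the inverse of \<open>E^3 E\<^sub>3^3\<close> (\<open>p33_fps_euler\<close>).  The tools are Jacobi's series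
  for \<open>E^3\<close>, the pentagonal number theorem, and the congruence of \<open>f(q)^p\<close> and \<open>f(q^p)\<close> modulo a
  prime \<open>p\<close>.  A congruence for an arithmetic progression follows once \<open>P\<close> has been multiplied by an
  invertible series in \<open>q^k\<close> that turns it into a series with a visible gap in that residue class.

  Modulo powers of 3.  In Jacobi's series the exponents congruent to 1 modulo 3 carry coefficients
  divisible by 3 and sum to \<open>-3 q E\<^sub>9^3\<close>; there are no exponents congruent to 2.  So
  \<open>E^3 = a - 3 x\<close> with \<open>a\<close> a series in \<open>q^3\<close> and \<open>x = q E\<^sub>9^3\<close>, and multiplying by
  \<open>a^2 + 3 a x + 9 x^2\<close> makes \<open>E^3\<close> the series \<open>a^3 - 27 x^3\<close> in \<open>q^3\<close>.  The part of \<open>P\<close> with exponents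
  congruent to 2 modulo 3 is therefore \<open>9 q^2\<close> times an explicit series in \<open>q^3\<close>, and modulo 3 that
  series even involves only powers of \<open>q^9\<close>.

  Modulo 5.  \<open>P E\<^sub>5 E\<^sub>1\<^sub>5\<close> is congruent to \<open>E^2 E\<^sub>3^2\<close>.  This series is a theta series with complex
  multiplication by the Eisenstein integers, in which 5 is inert.  In elementary terms,
  \<open>-4 E^3 E\<^sub>3^2\<close> is a difference of two sums over triples of integers, those with \<open>a\<close> congruent to \<open>b\<close>
  and those with \<open>a\<close> congruent to \<open>c\<close> modulo 3, where \<open>(a, b, c)\<close> has the weight \<open>c - b\<close> up to sign.
  Sorting by
  \<open>a + b + c\<close> modulo 3 and translating along \<open>(1, 1, 1)\<close> splits off a pentagonal factor \<open>E\<close>, so that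
  \<open>E^2 E\<^sub>3^2\<close> is a planar lattice sum; an exponent congruent to 3 modulo 5 makes the norm of
  \<open>(a - b, b - c)\<close> divisible by 5, hence also \<open>b - c\<close> (\<open>euler_square_dvd_5\<close>).

  Modulo 2 and 4.  All coefficients in Jacobi's series are 1 modulo 4, so \<open>E^3\<close> is congruent to
  the theta function \<open>\<psi>\<close>.  The form \<open>x^2 + 3 y^2\<close> represents a number by two odd integers twice as
  often as its quarter by integers of different parity; this is an exact 2-dissection of
  \<open>\<psi>(q) \<psi>(q^3)\<close> (\<open>psi_dissection\<close>) and hence a 2-dissection of \<open>E^3 E\<^sub>3^3\<close> modulo 4.  Modulo 2 the
  even and the odd part of \<open>P\<close> become quotients of the cubes of \<open>E\<close> and \<open>E\<^sub>3\<close>, and modulo 4 the even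
  part becomes \<open>E^3\<close> times a series in \<open>q^3\<close>; the 3-dissection of \<open>E^3\<close> then finishes the proof.
\<close>

section \<open>Congruences in a commutative ring\<close>

text \<open>
  Divisibility of the difference makes sense for a modulus in any commutative ring.  The modulus is
  an integer constant in the congruences between power series, and a power of \<open>X\<close> when infinite
  products are compared with their partial products.  The second congruent element is the last
  argument, which is what chains of congruences abbreviate by dots.
\<close>
definition rcong :: "'a::comm_ring_1 \<Rightarrow> 'a \<Rightarrow> 'a \<Rightarrow> bool"
  where "rcong m f g \<longleftrightarrow> m dvd f - g"

abbreviation rcong_syntax :: "'a::comm_ring_1 \<Rightarrow> 'a \<Rightarrow> 'a \<Rightarrow> bool" (\<open>[_ \<simeq> _] '(modulo _')\<close>)
  where "[f \<simeq> g] (modulo m) \<equiv> rcong m f g"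

lemma rcong_refl [simp]: "[f \<simeq> f] (modulo m)"
  by (simp add: rcong_def)

lemma rcong_sym: "[f \<simeq> g] (modulo m) \<Longrightarrow> [g \<simeq> f] (modulo m)"
  unfolding rcong_def by (metis dvd_minus_iff minus_diff_eq)

lemma rcong_trans [trans]: "[f \<simeq> g] (modulo m) \<Longrightarrow> [g \<simeq> h] (modulo m) \<Longrightarrow> [f \<simeq> h] (modulo m)"
  unfolding rcong_def by (metis diff_add_cancel add_diff_eq dvd_add)

lemma rcong_add: "[f \<simeq> g] (modulo m) \<Longrightarrow> [f' \<simeq> g'] (modulo m) \<Longrightarrow> [f + f' \<simeq> g + g'] (modulo m)"
  unfolding rcong_def by (metis add_diff_add dvd_add)

lemma rcong_diff:
  assumes "[f \<simeq> g] (modulo m)" "[f' \<simeq> g'] (modulo m)"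
  shows "[f - f' \<simeq> g - g'] (modulo m)"
proof -
  have "f - f' - (g - g') = (f - g) - (f' - g')"
    by simp
  then show ?thesis
    using assms unfolding rcong_def by (metis dvd_diff)
qed

lemma rcong_mult: "[f \<simeq> g] (modulo m) \<Longrightarrow> [f' \<simeq> g'] (modulo m) \<Longrightarrow> [f * f' \<simeq> g * g'] (modulo m)"
proof -
  assume "[f \<simeq> g] (modulo m)" "[f' \<simeq> g'] (modulo m)"
  then have "m dvd (f - g) * f' + g * (f' - g')"
    unfolding rcong_def by (intro dvd_add dvd_mult dvd_mult2)
  then show ?thesis
    unfolding rcong_def by (simp add: algebra_simps)
qed

lemma rcong_power: "[f \<simeq> g] (modulo m) \<Longrightarrow> [f ^ n \<simeq> g ^ n] (modulo m)"
  by (induction n) (auto intro: rcong_mult)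

lemma rcong_sum: "(\<And>i. i \<in> A \<Longrightarrow> [f i \<simeq> g i] (modulo m)) \<Longrightarrow> [sum f A \<simeq> sum g A] (modulo m)"
  by (induction A rule: infinite_finite_induct) (auto intro: rcong_add)

lemma rcong_prod: "(\<And>i. i \<in> A \<Longrightarrow> [f i \<simeq> g i] (modulo m)) \<Longrightarrow> [prod f A \<simeq> prod g A] (modulo m)"
  by (induction A rule: infinite_finite_induct) (auto intro: rcong_mult)

lemma rcong_cancel_unit:
  assumes "[f * u \<simeq> g * u] (modulo m)" "u dvd 1"
  shows "[f \<simeq> g] (modulo m)"
proof -
  from assms(2) obtain v where v: "u * v = 1"
    by (metis dvdE)
  have "m dvd (f * u - g * u) * v"
    using assms(1) by (simp add: rcong_def)
  moreover have "(f * u - g * u) * v = (f - g) * (u * v)"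
    by (simp add: algebra_simps)
  ultimately show ?thesis
    by (simp add: v rcong_def)
qed

lemma rcong_square_4: "[f \<simeq> g] (modulo 2) \<Longrightarrow> [f ^ 2 \<simeq> g ^ 2] (modulo 4)"
proof -
  assume "[f \<simeq> g] (modulo 2)"
  then obtain h where h: "f = g + 2 * h"
    unfolding rcong_def by (metis dvdE diff_eq_eq add.commute)
  have "f ^ 2 - g ^ 2 = 4 * (g * h + h ^ 2)"
    by (simp add: h power2_eq_square algebra_simps)
  then show ?thesis
    by (simp add: rcong_def)
qed

lemma rcong_dvd_modulus: "[f \<simeq> g] (modulo m) \<Longrightarrow> d dvd m \<Longrightarrow> [f \<simeq> g] (modulo d)"
  unfolding rcong_def by (rule dvd_trans)

lemma numeral_dvd_fps_iff:
  "(numeral k :: int fps) dvd f \<longleftrightarrow> (\<forall>n. numeral k dvd f $ n)"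
proof
  assume "(numeral k :: int fps) dvd f"
  then obtain h where "f = numeral k * h" by (rule dvdE)
  then have "f $ n = numeral k * h $ n" for n
    by (simp add: numeral_fps_const)
  then show "\<forall>n. numeral k dvd f $ n" by simp
next
  assume "\<forall>n. numeral k dvd f $ n"
  then have "f = numeral k * Abs_fps (\<lambda>n. f $ n div numeral k)"
    by (simp add: fps_eq_iff numeral_fps_const)
  then show "numeral k dvd f"
    by (rule dvdI)
qed

lemma rcong_fps_iff:
  fixes f g :: "int fps"
  shows "[f \<simeq> g] (modulo (numeral k)) \<longleftrightarrow> (\<forall>n. numeral k dvd f $ n - g $ n)"
  by (simp add: rcong_def numeral_dvd_fps_iff)

lemma rcong_X_power_iff:
  fixes f g :: "'a::comm_ring_1 fps"
  shows "[f \<simeq> g] (modulo (fps_X ^ N)) \<longleftrightarrow> (\<forall>n<N. f $ n = g $ n)"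
proof
  assume "[f \<simeq> g] (modulo (fps_X ^ N))"
  then obtain h where "f - g = fps_X ^ N * h"
    unfolding rcong_def by (rule dvdE)
  then have "(f - g) $ n = 0" if "n < N" for n
    using that by (simp add: fps_X_power_mult_nth)
  then show "\<forall>n<N. f $ n = g $ n"
    by simp
next
  assume *: "\<forall>n<N. f $ n = g $ n"
  have "f - g = fps_X ^ N * fps_shift N (f - g)"
    using * by (intro fps_ext) (auto simp: fps_X_power_mult_nth)
  then show "[f \<simeq> g] (modulo (fps_X ^ N))"
    unfolding rcong_def by (rule dvdI)
qed

lemma fps_unit_int:
  fixes f :: "int fps"
  assumes "f $ 0 = 1"
  shows "f dvd 1"
  using fps_right_inverse[of f 1] assms by (metis dvdI mult.right_neutral)

section \<open>The substitution of a power of q\<close>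

definition dil :: "nat \<Rightarrow> 'a::comm_ring_1 fps \<Rightarrow> 'a fps" where
  "dil k f = f oo fps_X ^ k"

lemma dil_nth: "k > 0 \<Longrightarrow> dil k f $ n = (if k dvd n then f $ (n div k) else 0)"
  unfolding dil_def by (rule fps_nth_compose_X_power)

lemma dil_nth_0 [simp]: "dil k f $ 0 = f $ 0"
  by (simp add: dil_def)

lemma dil_simps [simp]:
  "dil k (f + g) = dil k f + dil k g"
  "dil k (f - g) = dil k f - dil k g"
  "dil k (- f) = - dil k f"
  "dil k 0 = 0" "dil k 1 = 1" "dil k (numeral c) = numeral c"
  by (simp_all add: dil_def fps_compose_add_distrib fps_compose_sub_distrib fps_compose_uminus)

lemma dil_mult [simp]:
  fixes f g :: "'a::idom fps"
  shows "k > 0 \<Longrightarrow> dil k (f * g) = dil k f * dil k g"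
  by (simp add: dil_def fps_compose_mult_distrib)

lemma dil_power [simp]:
  fixes f :: "'a::idom fps"
  shows "k > 0 \<Longrightarrow> dil k (f ^ n) = dil k f ^ n"
  by (simp add: dil_def fps_compose_power)

lemma dil_prod:
  fixes f :: "'b \<Rightarrow> 'a::idom fps"
  assumes "k > 0"
  shows "dil k (prod f A) = (\<Prod>x\<in>A. dil k (f x))"
  by (induction A rule: infinite_finite_induct) (use assms in auto)

lemma dil_X [simp]: "k > 0 \<Longrightarrow> dil k fps_X = fps_X ^ k"
  by (simp add: dil_def)

lemma dil_1 [simp]: "dil (Suc 0) f = f"
  by (simp add: dil_def)

lemma dil_dil [simp]:
  assumes "j > 0" "k > 0"
  shows "dil j (dil k f) = dil (j * k) f"
proof (rule fps_ext)
  fix n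
  show "dil j (dil k f) $ n = dil (j * k) f $ n"
  proof (cases "j dvd n")
    case True
    then obtain m where "n = j * m" by (rule dvdE)
    then show ?thesis using assms by (simp add: dil_nth)
  next
    case False
    then have "\<not> j * k dvd n" by (meson dvd_mult_left)
    then show ?thesis using False assms by (simp add: dil_nth)
  qed
qed

lemma rcong_dil:
  fixes f g :: "int fps"
  assumes "[f \<simeq> g] (modulo (numeral c))" "k > 0"
  shows "[dil k f \<simeq> dil k g] (modulo (numeral c))"
  using assms by (simp add: rcong_fps_iff dil_nth)

text \<open>
  The inner binomial coefficients of a prime exponent are divisible by it.
\<close>
lemma rcong_prime_power_add:
  fixes f g :: "'a::comm_ring_1"
  assumes "prime p"
  shows "[(f + g) ^ p \<simeq> f ^ p + g ^ p] (modulo (of_nat p))"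
proof -
  have p: "p > 0" using assms by (rule prime_gt_0_nat)
  have "(f + g) ^ p = (\<Sum>i\<le>p. of_nat (p choose i) * f ^ i * g ^ (p - i))"
    by (rule binomial_ring)
  also have "{..p} = insert 0 (insert p {0<..<p})"
    by auto
  also have "(\<Sum>i\<in>\<dots>. of_nat (p choose i) * f ^ i * g ^ (p - i)) =
      g ^ p + (f ^ p + (\<Sum>i\<in>{0<..<p}. of_nat (p choose i) * f ^ i * g ^ (p - i)))"
    using p by simp
  also have "\<dots> - (f ^ p + g ^ p) = (\<Sum>i\<in>{0<..<p}. of_nat (p choose i) * f ^ i * g ^ (p - i))"
    by simp
  also have "of_nat p dvd \<dots>"
  proof (intro dvd_sum dvd_mult2)
    fix i assume "i \<in> {0<..<p}"
    then have "p dvd (p choose i)"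
      using dvd_choose_prime[OF _ _ _ assms, of i] by simp
    then show "(of_nat p :: 'a) dvd of_nat (p choose i)"
      by (metis dvdE dvdI of_nat_mult)
  qed
  finally show ?thesis
    by (simp add: rcong_def)
qed

text \<open>
  By additivity of the \<open>p\<close>-th power this is an induction over the natural numbers, which represent
  all residue classes.
\<close>
lemma fermat_int:
  assumes "prime p"
  shows "[c ^ p \<simeq> c] (modulo (int p))"
proof -
  have p: "p > 0" using assms by (rule prime_gt_0_nat)
  have nat_case: "[int n ^ p \<simeq> int n] (modulo (int p))" for n
  proof (induction n)
    case 0
    show ?case using p by (simp add: zero_power)
  next
    case (Suc n)
    have "[(int n + 1) ^ p \<simeq> int n ^ p + 1 ^ p] (modulo (int p))"
      using rcong_prime_power_add[OF assms, of "int n" 1] by simp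
    also have "[int n ^ p + 1 ^ p \<simeq> int n + 1] (modulo (int p))"
      using Suc.IH by (auto intro: rcong_add)
    finally show ?case by (simp add: add.commute)
  qed
  have c: "[c \<simeq> int (nat (c mod int p))] (modulo (int p))"
    using p by (simp add: rcong_def)
  have "[c ^ p \<simeq> int (nat (c mod int p)) ^ p] (modulo (int p))"
    by (rule rcong_power[OF c])
  also note nat_case
  also note rcong_sym[OF c]
  finally show ?thesis .
qed

text \<open>
  Split off the constant term: \<open>f = c + X g\<close> gives \<open>f^p\<close> congruent to \<open>c^p + X^p g^p\<close>, where \<open>c^p\<close> is
  congruent to \<open>c\<close> by Fermat, and the coefficient of \<open>g^p\<close> in question has a smaller index.
\<close>
lemma fps_power_prime_rcong_dil:
  fixes f :: "int fps"
  assumes "prime p"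
  shows "[f ^ p \<simeq> dil p f] (modulo (of_nat p))"
proof -
  have p: "p > 0" using assms by (rule prime_gt_0_nat)
  have of_nat_fps: "(of_nat p :: int fps) = fps_const (int p)"
    by (simp add: fps_of_nat)
  have "\<forall>f :: int fps. int p dvd (f ^ p) $ n - dil p f $ n" for n
  proof (induction n rule: less_induct)
    case (less n)
    show ?case
    proof
      fix f :: "int fps"
      define c where "c = f $ 0"
      define g where "g = fps_shift 1 f"
      have f: "f = fps_const c + fps_X * g"
        by (rule fps_ext) (auto simp: c_def g_def)
      have dil_f: "dil p f = fps_const c + fps_X ^ p * dil p g"
        unfolding f using p
        by (simp add: dil_def fps_compose_mult_distrib fps_compose_add_distrib)
      have "[f ^ p \<simeq> fps_const c ^ p + (fps_X * g) ^ p] (modulo (of_nat p))"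
        unfolding f by (rule rcong_prime_power_add[OF assms])
      then obtain h where h: "f ^ p = fps_const (c ^ p) + fps_X ^ p * g ^ p + fps_const (int p) * h"
        unfolding rcong_def of_nat_fps
        by (metis dvdE diff_eq_eq add.commute power_mult_distrib fps_const_power)
      have "(f ^ p) $ n - dil p f $ n = (fps_const (c ^ p) - fps_const c) $ n +
          (fps_X ^ p * g ^ p - fps_X ^ p * dil p g) $ n + int p * h $ n"
        unfolding h dil_f by simp
      moreover have "int p dvd (fps_const (c ^ p) - fps_const c) $ n"
        using fermat_int[OF assms, of c] by (simp add: rcong_def)
      moreover have "int p dvd (fps_X ^ p * g ^ p - fps_X ^ p * dil p g) $ n"
        using less.IH[of "n - p"] p by (auto simp: fps_X_power_mult_nth)
      ultimately show "int p dvd (f ^ p) $ n - dil p f $ n"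
        by (auto intro: dvd_add)
    qed
  qed
  then have "f ^ p - dil p f = of_nat p * Abs_fps (\<lambda>n. ((f ^ p) $ n - dil p f $ n) div int p)"
    by (simp add: fps_eq_iff of_nat_fps)
  then show ?thesis
    unfolding rcong_def by (rule dvdI)
qed

section \<open>Coefficients along an arithmetic progression\<close>

text \<open>
  The series \<open>f(k n + r)\<close>: for \<open>r = 0\<close> this is the operator \<open>U\<^sub>k\<close> of the theory of modular forms.  It is
  linear over series in \<open>q^k\<close> (\<open>sec_dil_mult\<close>), which is how congruences for progressions are
  extracted from identities.
\<close>
definition sec :: "nat \<Rightarrow> nat \<Rightarrow> 'a::comm_ring_1 fps \<Rightarrow> 'a fps" where
  "sec k r f = Abs_fps (\<lambda>n. f $ (k * n + r))"

lemma sec_nth [simp]: "sec k r f $ n = f $ (k * n + r)"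
  by (simp add: sec_def)

lemma sec_simps:
  "sec k r (f + g) = sec k r f + sec k r g"
  "sec k r (f - g) = sec k r f - sec k r g"
  "sec k r (numeral c * f) = numeral c * sec k r f"
  "sec k r (f * numeral c) = sec k r f * numeral c"
  by (simp_all add: fps_eq_iff numeral_fps_const)

lemma sec_X_mult:
  "sec k (Suc r) (fps_X * f) = sec k r f"
  "k > 0 \<Longrightarrow> sec k 0 (fps_X * f) = fps_X * sec k (k - 1) f"
proof -
  show "sec k (Suc r) (fps_X * f) = sec k r f"
    by (simp add: fps_eq_iff)
next
  assume k: "k > 0"
  show "sec k 0 (fps_X * f) = fps_X * sec k (k - 1) f"
  proof (rule fps_ext)
    fix n
    show "sec k 0 (fps_X * f) $ n = (fps_X * sec k (k - 1) f) $ n"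
    proof (cases n)
      case (Suc m)
      have "k * Suc m - 1 = k * m + (k - 1)"
        using k by simp
      then show ?thesis using k Suc by simp
    qed simp
  qed
qed

lemma sec_dil_mult:
  assumes "r < k"
  shows "sec k r (dil k g * f) = g * sec k r f"
proof (rule fps_ext)
  fix n
  have k: "k > 0" using assms by simp
  have "sec k r (dil k g * f) $ n = (\<Sum>i\<in>{0..k * n + r}. dil k g $ i * f $ (k * n + r - i))"
    by (simp add: fps_mult_nth)
  also have "\<dots> = (\<Sum>i\<in>(*) k ` {0..n}. dil k g $ i * f $ (k * n + r - i))"
  proof (intro sum.mono_neutral_right ballI)
    fix i assume i: "i \<in> {0..k * n + r} - (*) k ` {0..n}"
    have "\<not> k dvd i"
    proof
      assume "k dvd i"
      then obtain m where m: "i = k * m" by (rule dvdE)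
      then have "k * m < k * (n + 1)" using i assms by auto
      then have "m < n + 1" using k by (simp only: mult_less_cancel1)
      then show False using i m by auto
    qed
    then show "dil k g $ i * f $ (k * n + r - i) = 0"
      using k by (simp add: dil_nth)
  qed (auto simp: trans_le_add1)
  also have "\<dots> = (\<Sum>m = 0..n. g $ m * f $ (k * (n - m) + r))"
    using k by (subst sum.reindex) (auto simp: inj_on_def dil_nth diff_mult_distrib2 intro!: sum.cong)
  also have "\<dots> = (g * sec k r f) $ n"
    by (simp add: fps_mult_nth)
  finally show "sec k r (dil k g * f) $ n = (g * sec k r f) $ n" .
qed

lemma sec_mult_dil: "r < k \<Longrightarrow> sec k r (f * dil k g) = sec k r f * g"
  using sec_dil_mult[of r k g f] by (simp add: mult.commute)

lemma sec_dil [simp]: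
  "k > 0 \<Longrightarrow> sec k 0 (dil k f) = f"
  "0 < r \<Longrightarrow> r < k \<Longrightarrow> sec k r (dil k f) = 0"
  by (auto simp: fps_eq_iff dil_nth dvd_add_right_iff dest: dvd_imp_le)

lemma sec_sec: "sec k r (sec j s f) = sec (j * k) (j * r + s) f"
  by (simp add: fps_eq_iff algebra_simps)

lemma rcong_sec:
  fixes f g :: "int fps"
  shows "[f \<simeq> g] (modulo (numeral c)) \<Longrightarrow> [sec k r f \<simeq> sec k r g] (modulo (numeral c))"
  by (simp add: rcong_fps_iff)

section \<open>Series of the form sum w(x) q^e(x)\<close>

text \<open>
  Without this condition the coefficients of the following series would be sums over infinite
  sets, which are 0 by convention, and products could not be formed.
\<close>
definition fin_fibres :: "'a set \<Rightarrow> ('a \<Rightarrow> nat) \<Rightarrow> bool" where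
  "fin_fibres A e \<longleftrightarrow> (\<forall>n. finite {x \<in> A. e x = n})"

definition gser :: "'a set \<Rightarrow> ('a \<Rightarrow> nat) \<Rightarrow> ('a \<Rightarrow> int) \<Rightarrow> int fps" where
  "gser A e w = Abs_fps (\<lambda>n. \<Sum>x | x \<in> A \<and> e x = n. w x)"

lemma gser_nth: "gser A e w $ n = (\<Sum>x | x \<in> A \<and> e x = n. w x)"
  by (simp add: gser_def)

lemma gser_cong:
  assumes "\<And>x. x \<in> A \<Longrightarrow> e x = f x" "\<And>x. x \<in> A \<Longrightarrow> w x = v x"
  shows "gser A e w = gser A f v"
proof (rule fps_ext)
  fix n
  have "{x. x \<in> A \<and> e x = n} = {x. x \<in> A \<and> f x = n}"
    by (intro Collect_cong conj_cong refl) (simp add: assms(1))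
  then show "gser A e w $ n = gser A f v $ n"
    unfolding gser_nth by (simp only:) (rule sum.cong[OF refl], simp add: assms(2))
qed

lemma gser_add: "gser A e (\<lambda>x. w x + v x) = gser A e w + gser A e v"
  by (simp add: fps_eq_iff gser_nth sum.distrib)

lemma gser_diff: "gser A e (\<lambda>x. w x - v x) = gser A e w - gser A e v"
  by (simp add: fps_eq_iff gser_nth sum_subtractf)

lemma gser_minus: "gser A e (\<lambda>x. - w x) = - gser A e w"
  by (simp add: fps_eq_iff gser_nth sum_negf)

lemma gser_cmult: "gser A e (\<lambda>x. numeral c * w x) = numeral c * gser A e w"
  by (simp add: fps_eq_iff gser_nth numeral_fps_const sum_distrib_left)

lemma fin_fibres_subset:
  assumes "fin_fibres A e" "B \<subseteq> A"
  shows "fin_fibres B e"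
  unfolding fin_fibres_def
proof
  fix n
  have "{x \<in> B. e x = n} \<subseteq> {x \<in> A. e x = n}"
    using assms(2) by auto
  moreover have "finite {x \<in> A. e x = n}"
    using assms(1) by (simp add: fin_fibres_def)
  ultimately show "finite {x \<in> B. e x = n}"
    by (rule finite_subset)
qed

lemma gser_Un_disjoint:
  assumes "fin_fibres (A \<union> B) e" "A \<inter> B = {}"
  shows "gser (A \<union> B) e w = gser A e w + gser B e w"
proof (rule fps_ext)
  fix n
  have "{x. x \<in> A \<union> B \<and> e x = n} = {x. x \<in> A \<and> e x = n} \<union> {x. x \<in> B \<and> e x = n}"
    by auto
  moreover have "finite {x. x \<in> A \<and> e x = n}" "finite {x. x \<in> B \<and> e x = n}"
    using fin_fibres_subset[OF assms(1)] by (simp_all add: fin_fibres_def)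
  moreover have "{x. x \<in> A \<and> e x = n} \<inter> {x. x \<in> B \<and> e x = n} = {}"
    using assms(2) by blast
  ultimately show "gser (A \<union> B) e w $ n = (gser A e w + gser B e w) $ n"
    by (simp only: gser_nth fps_add_nth sum.union_disjoint)
qed

lemma gser_reindex:
  assumes "bij_betw h B A"
  shows "gser A e w = gser B (\<lambda>x. e (h x)) (\<lambda>x. w (h x))"
proof (rule fps_ext)
  fix n
  have "bij_betw h {x. x \<in> B \<and> e (h x) = n} {x. x \<in> A \<and> e x = n}"
    using assms unfolding bij_betw_def by (auto simp: inj_on_def)
  then show "gser A e w $ n = gser B (\<lambda>x. e (h x)) (\<lambda>x. w (h x)) $ n"
    by (simp add: gser_nth sum.reindex_bij_betw)
qed

lemma gser_eq_0_involution:
  assumes "bij_betw h A A" "\<And>x. x \<in> A \<Longrightarrow> e (h x) = e x" "\<And>x. x \<in> A \<Longrightarrow> w (h x) = - w x"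
  shows "gser A e w = 0"
proof -
  have "gser A e w = gser A (\<lambda>x. e (h x)) (\<lambda>x. w (h x))"
    by (rule gser_reindex[OF assms(1)])
  also have "\<dots> = gser A e (\<lambda>x. - w x)"
    using assms by (intro gser_cong) auto
  also have "\<dots> = - gser A e w"
    by (rule gser_minus)
  finally show ?thesis
    by (simp add: fps_eq_iff)
qed

lemma fin_fibres_Times:
  assumes "fin_fibres A e" "fin_fibres B f"
  shows "fin_fibres (A \<times> B) (\<lambda>(x, y). e x + f y)"
  unfolding fin_fibres_def
proof
  fix n
  have "{z \<in> A \<times> B. (case z of (x, y) \<Rightarrow> e x + f y) = n} \<subseteq>
      (\<Union>i\<le>n. {x \<in> A. e x = i} \<times> {y \<in> B. f y = n - i})"
    by auto
  moreover have "finite \<dots>"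
    using assms by (auto simp: fin_fibres_def)
  ultimately show "finite {z \<in> A \<times> B. (case z of (x, y) \<Rightarrow> e x + f y) = n}"
    by (rule finite_subset)
qed

lemma gser_mult:
  assumes "fin_fibres A e" "fin_fibres B f"
  shows "gser A e w * gser B f v = gser (A \<times> B) (\<lambda>(x, y). e x + f y) (\<lambda>(x, y). w x * v y)"
proof (rule fps_ext)
  fix n
  have fin: "finite {x. x \<in> A \<and> e x = i}" "finite {x. x \<in> B \<and> f x = i}" for i
    using assms by (auto simp: fin_fibres_def)
  have "(gser A e w * gser B f v) $ n =
      (\<Sum>i = 0..n. (\<Sum>x | x \<in> A \<and> e x = i. w x) * (\<Sum>y | y \<in> B \<and> f y = n - i. v y))"
    by (simp add: fps_mult_nth gser_nth)
  also have "\<dots> = (\<Sum>i = 0..n. \<Sum>(x, y) \<in> {x. x \<in> A \<and> e x = i} \<times> {y. y \<in> B \<and> f y = n - i}. w x * v y)"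
    by (simp add: sum_product sum.cartesian_product)
  also have "\<dots> = (\<Sum>(x, y) \<in> (\<Union>i\<in>{0..n}. {x. x \<in> A \<and> e x = i} \<times> {y. y \<in> B \<and> f y = n - i}). w x * v y)"
    by (rule sum.UNION_disjoint[symmetric]) (use fin in auto)
  also have "(\<Union>i\<in>{0..n}. {x. x \<in> A \<and> e x = i} \<times> {y. y \<in> B \<and> f y = n - i}) =
      {z. z \<in> A \<times> B \<and> (case z of (x, y) \<Rightarrow> e x + f y) = n}"
    by auto
  finally show "(gser A e w * gser B f v) $ n =
      gser (A \<times> B) (\<lambda>(x, y). e x + f y) (\<lambda>(x, y). w x * v y) $ n"
    by (simp add: gser_nth)
qed

lemma gser_dil:
  assumes "k > 0"
  shows "dil k (gser A e w) = gser A (\<lambda>x. k * e x) w"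
proof (rule fps_ext)
  fix n
  show "dil k (gser A e w) $ n = gser A (\<lambda>x. k * e x) w $ n"
  proof (cases "k dvd n")
    case True
    then obtain m where "n = k * m" by (rule dvdE)
    then show ?thesis using assms by (simp add: dil_nth gser_nth)
  next
    case False
    then have none: "{x. x \<in> A \<and> k * e x = n} = {}" by auto
    show ?thesis using False assms by (simp add: dil_nth gser_nth none)
  qed
qed

lemma gser_X_power: "fps_X ^ k * gser A e w = gser A (\<lambda>x. k + e x) w"
proof (rule fps_ext)
  fix n
  show "(fps_X ^ k * gser A e w) $ n = gser A (\<lambda>x. k + e x) w $ n"
  proof (cases "n < k")
    case True
    then have "{x. x \<in> A \<and> k + e x = n} = {}" by auto
    with True show ?thesis by (simp add: fps_X_power_mult_nth gser_nth)
  next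
    case False
    then have "{x. x \<in> A \<and> k + e x = n} = {x. x \<in> A \<and> e x = n - k}" by auto
    with False show ?thesis by (simp add: fps_X_power_mult_nth gser_nth)
  qed
qed

lemma gser_rcong:
  assumes "\<And>x. x \<in> A \<Longrightarrow> numeral c dvd w x - v x"
  shows "[gser A e w \<simeq> gser A e v] (modulo (numeral c))"
  unfolding rcong_fps_iff gser_nth sum_subtractf[symmetric]
  by (intro allI dvd_sum assms) simp

section \<open>Euler's product\<close>

definition qfac :: "nat \<Rightarrow> int fps" where
  "qfac n = (\<Prod>k=1..n. 1 - fps_X ^ k)"

text \<open>
  The first \<open>n + 1\<close> coefficients of the infinite product are those of its \<open>n\<close>-th partial product.
\<close>
definition euler :: "int fps" where
  "euler = Abs_fps (\<lambda>n. qfac n $ n)"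

lemma qfac_0 [simp]: "qfac 0 = 1"
  by (simp add: qfac_def)

lemma qfac_Suc: "qfac (Suc n) = qfac n * (1 - fps_X ^ Suc n)"
  by (simp add: qfac_def)

lemma rcong_X_power_le: "[f \<simeq> g] (modulo (fps_X ^ N)) \<Longrightarrow> M \<le> N \<Longrightarrow> [f \<simeq> g] (modulo (fps_X ^ M))"
  using rcong_dvd_modulus le_imp_power_dvd by blast

lemma rcong_X_power_mult:
  assumes "[f \<simeq> g] (modulo (fps_X ^ a))" "c \<le> a + b"
  shows "[fps_X ^ b * f \<simeq> fps_X ^ b * g] (modulo (fps_X ^ c))"
proof -
  have "fps_X ^ (b + a) dvd fps_X ^ b * (f - g)"
    using assms(1) unfolding rcong_def power_add by (intro mult_dvd_mono) auto
  then have "[fps_X ^ b * f \<simeq> fps_X ^ b * g] (modulo (fps_X ^ (b + a)))"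
    by (simp add: rcong_def algebra_simps)
  then show ?thesis
    by (rule rcong_X_power_le) (use assms(2) in simp)
qed

lemma qfac_rcong:
  assumes "m \<le> n"
  shows "[qfac n \<simeq> qfac m] (modulo (fps_X ^ Suc m))"
  using assms
proof (induction n rule: dec_induct)
  case (step n)
  have "[qfac n - fps_X ^ Suc n * qfac n \<simeq> qfac m - 0] (modulo (fps_X ^ Suc m))"
  proof (rule rcong_diff[OF step.IH])
    show "[fps_X ^ Suc n * qfac n \<simeq> 0] (modulo (fps_X ^ Suc m))"
      unfolding rcong_def diff_0_right
      by (intro dvd_mult2 le_imp_power_dvd) (use step in simp)
  qed
  then show ?case
    by (simp add: qfac_Suc algebra_simps)
qed simp

lemma euler_rcong_qfac: "[euler \<simeq> qfac n] (modulo (fps_X ^ Suc n))"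
  unfolding rcong_X_power_iff
proof (intro allI impI)
  fix i assume "i < Suc n"
  then show "euler $ i = qfac n $ i"
    using qfac_rcong[of i n] by (simp add: euler_def rcong_X_power_iff del: power_Suc)
qed

lemma euler_0 [simp]: "euler $ 0 = 1"
  by (simp add: euler_def)

lemma qfac_nth_0 [simp]: "qfac n $ 0 = 1"
  by (induction n) (auto simp: qfac_Suc)

lemma fps_eqI_rcong_X_power:
  assumes "\<And>N. [f \<simeq> g] (modulo (fps_X ^ Suc N))"
  shows "f = g"
  using assms by (intro fps_ext) (auto simp: rcong_X_power_iff simp del: power_Suc)

section \<open>The pentagonal number theorem\<close>

definition alt :: "int \<Rightarrow> int" where
  "alt k = (if even k then 1 else - 1)"

lemma alt_add: "alt (a + b) = alt a * alt b"
  by (simp add: alt_def)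

lemma alt_minus [simp]: "alt (- a) = alt a"
  by (simp add: alt_def)

definition pent :: "int \<Rightarrow> nat" where
  "pent k = nat (k * (3 * k - 1) div 2)"

lemma pent_eq: "2 * int (pent k) = k * (3 * k - 1)"
proof -
  have "even (k * (3 * k - 1))" by simp
  moreover have "k * (3 * k - 1) \<ge> 0"
    by (cases "k > 0") (auto intro: mult_nonneg_nonneg mult_nonpos_nonpos)
  ultimately show ?thesis
    unfolding pent_def by (auto elim!: evenE)
qed

text \<open>
  Triangular numbers indexed by all integers, so that each of them occurs for exactly two indices
  \<open>a\<close> and \<open>1 - a\<close>.  This indexing lets lattice translations act.
\<close>
definition triz :: "int \<Rightarrow> nat" where
  "triz a = nat (a * (a - 1) div 2)"

lemma triz_eq: "2 * int (triz a) = a * (a - 1)"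
proof -
  have "even (a * (a - 1))" by simp
  moreover have "a * (a - 1) \<ge> 0"
    by (cases "a > 0") (auto intro: mult_nonneg_nonneg mult_nonpos_nonpos)
  ultimately show ?thesis
    unfolding triz_def by (auto elim!: evenE)
qed

lemma pent_ge: "\<bar>k\<bar> \<le> int (pent k)"
proof (cases "k = 0")
  case False
  then consider "k \<ge> 1" | "k \<le> -1" by linarith
  then have "2 * \<bar>k\<bar> \<le> k * (3 * k - 1)"
  proof cases
    case 1
    then have "k * 2 \<le> k * (3 * k - 1)" by (intro mult_left_mono) auto
    with 1 show ?thesis by simp
  next
    case 2
    then have "(- k) * 2 \<le> (- k) * (1 - 3 * k)" by (intro mult_left_mono) auto
    with 2 show ?thesis by (simp add: algebra_simps)
  qed
  then show ?thesis using pent_eq[of k] by linarith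
qed simp

lemma triz_ge: "\<bar>a\<bar> \<le> int (triz a) + 1"
proof -
  have "0 \<le> (a - 1) * (a - 2)" "0 \<le> a * (a + 1)"
    by (cases "a \<ge> 2"; auto intro: mult_nonneg_nonneg mult_nonpos_nonpos)
       (cases "a \<ge> 0"; auto intro: mult_nonneg_nonneg mult_nonpos_nonpos)
  then show ?thesis using triz_eq[of a] by (auto simp: algebra_simps)
qed

lemma fin_fibres_int:
  assumes "\<And>k. \<bar>k\<bar> \<le> int (e k) + 1"
  shows "fin_fibres A e"
  unfolding fin_fibres_def
proof
  fix n
  have "{x \<in> A. e x = n} \<subseteq> {- (int n + 1)..int n + 1}"
    using assms by (auto simp: abs_le_iff) (smt (verit) assms)+
  then show "finite {x \<in> A. e x = n}"
    by (rule finite_subset) simp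
qed

lemma fin_fibres_pent: "fin_fibres A pent"
  by (rule fin_fibres_int) (use pent_ge in \<open>smt (verit)\<close>)

lemma fin_fibres_triz: "fin_fibres A triz"
  by (rule fin_fibres_int) (rule triz_ge)

lemma gser_rcong_X_power:
  assumes "fin_fibres A e" "finite B" "B \<subseteq> A" "\<And>x. x \<in> A - B \<Longrightarrow> N \<le> e x"
  shows "[gser A e w \<simeq> (\<Sum>x\<in>B. fps_const (w x) * fps_X ^ e x)] (modulo (fps_X ^ N))"
  unfolding rcong_X_power_iff
proof (intro allI impI)
  fix n assume n: "n < N"
  have "{x. x \<in> A \<and> e x = n} = {x \<in> B. e x = n}"
    using assms(3,4) n by fastforce
  then have "gser A e w $ n = (\<Sum>x\<in>B. if e x = n then w x else 0)"
    using assms(2) by (simp add: gser_nth sum.inter_filter)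
  also have "\<dots> = (\<Sum>x\<in>B. fps_const (w x) * fps_X ^ e x) $ n"
    by (auto simp: fps_sum_nth intro!: sum.cong)
  finally show "gser A e w $ n = (\<Sum>x\<in>B. fps_const (w x) * fps_X ^ e x) $ n" .
qed

definition tri :: "nat \<Rightarrow> nat" where
  "tri n = n * (n + 1) div 2"

lemma tri_0 [simp]: "tri 0 = 0"
  by (simp add: tri_def)

lemma tri_Suc [simp]: "tri (Suc n) = tri n + Suc n"
  by (simp add: tri_def)

lemma tri_ge: "n \<le> tri n"
  by (induction n) auto

lemma tri_int: "2 * int (tri n) = int n * (int n + 1)"
  by (induction n) (auto simp: algebra_simps)

definition qfac_quot :: "nat \<Rightarrow> nat \<Rightarrow> int fps" where
  "qfac_quot n s = (\<Prod>k=Suc s..n. 1 - fps_X ^ k)"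

lemma qfac_quot_Suc: "s \<le> n \<Longrightarrow> qfac_quot (Suc n) s = qfac_quot n s * (1 - fps_X ^ Suc n)"
  by (simp add: qfac_quot_def)

lemma qfac_quot_rec: "s < n \<Longrightarrow> qfac_quot n (Suc s) * (1 - fps_X ^ Suc s) = qfac_quot n s"
  by (simp add: qfac_quot_def prod.atLeast_Suc_atMost mult.commute)

lemma qfac_quot_same [simp]: "qfac_quot n n = 1"
  by (simp add: qfac_quot_def)

lemma qfac_quot_0: "qfac_quot n 0 = qfac n"
  by (simp add: qfac_quot_def qfac_def)

text \<open>
  The finite sums of Shanks.  Modulo \<open>X^(n + 1)\<close> only the term for \<open>s = 0\<close>, the partial Euler product,
  survives, while passing from \<open>n\<close> to \<open>n + 1\<close> adds exactly two pentagonal powers.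
\<close>
definition shanks :: "nat \<Rightarrow> int fps" where
  "shanks n = (\<Sum>s\<le>n. (- 1) ^ s * qfac_quot n s * fps_X ^ (s * n + tri s))"

text \<open>
  Replacing \<open>n\<close> by \<open>n + 1\<close> changes the summand \<open>t s\<close> by \<open>- t s (1 - X^s) - t s X^(s + n + 1)\<close>.  The first
  change at \<open>s + 1\<close> cancels the second at \<open>s\<close>, so that the sum telescopes.
\<close>
lemma shanks_Suc:
  "shanks (Suc n) = shanks n +
     (- 1) ^ Suc n * (fps_X ^ (Suc n * n + tri (Suc n)) + fps_X ^ (Suc n * Suc n + tri (Suc n)))"
proof -
  let ?X = "fps_X :: int fps"
  define t where "t s = (- 1) ^ s * qfac_quot n s * ?X ^ (s * n + tri s)" for s
  have "shanks (Suc n) = (\<Sum>s\<le>n. (- 1) ^ s * qfac_quot (Suc n) s * ?X ^ (s * Suc n + tri s)) +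
      (- 1) ^ Suc n * ?X ^ (Suc n * Suc n + tri (Suc n))"
    by (simp add: shanks_def del: tri_Suc)
  also have "(\<Sum>s\<le>n. (- 1) ^ s * qfac_quot (Suc n) s * ?X ^ (s * Suc n + tri s)) =
      (\<Sum>s\<le>n. t s - t s * (1 - ?X ^ s) - t s * ?X ^ (s + Suc n))"
  proof (rule sum.cong)
    fix s assume "s \<in> {..n}"
    then show "(- 1) ^ s * qfac_quot (Suc n) s * ?X ^ (s * Suc n + tri s) =
        t s - t s * (1 - ?X ^ s) - t s * ?X ^ (s + Suc n)"
      by (simp add: t_def qfac_quot_Suc power_add algebra_simps)
  qed simp
  also have "\<dots> = shanks n - (\<Sum>s\<le>n. t s * (1 - ?X ^ s)) - (\<Sum>s\<le>n. t s * ?X ^ (s + Suc n))"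
    by (simp add: sum_subtractf t_def shanks_def)
  also have "(\<Sum>s\<le>n. t s * (1 - ?X ^ s)) = (\<Sum>s<n. t (Suc s) * (1 - ?X ^ Suc s))"
    using sum.atMost_shift[of "\<lambda>s. t s * (1 - ?X ^ s)" n] by simp
  also have "\<dots> = (\<Sum>s<n. - (t s * ?X ^ (s + Suc n)))"
  proof (rule sum.cong)
    fix s assume s: "s \<in> {..<n}"
    have "t (Suc s) * (1 - ?X ^ Suc s) =
        - ((- 1) ^ s * (qfac_quot n (Suc s) * (1 - ?X ^ Suc s)) * ?X ^ (Suc s * n + tri (Suc s)))"
      by (simp add: t_def del: tri_Suc)
    also have "\<dots> = - (t s * ?X ^ (s + Suc n))"
      using s unfolding qfac_quot_rec[OF iffD1[OF lessThan_iff s]] by (simp add: t_def power_add mult_ac)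
    finally show "t (Suc s) * (1 - ?X ^ Suc s) = - (t s * ?X ^ (s + Suc n))" .
  qed simp
  also have "(\<Sum>s\<le>n. t s * ?X ^ (s + Suc n)) = (\<Sum>s<n. t s * ?X ^ (s + Suc n)) + t n * ?X ^ (n + Suc n)"
    by (simp add: lessThan_Suc_atMost[symmetric])
  also have "t n * ?X ^ (n + Suc n) = (- 1) ^ n * ?X ^ (Suc n * n + tri (Suc n))"
    by (simp add: t_def power_add mult_ac)
  finally show ?thesis
    by (simp add: sum_negf algebra_simps)
qed

lemma shanks_eq: "shanks n = (\<Sum>k = - int n..int n. fps_const (alt k) * fps_X ^ pent k)"
proof (induction n)
  case 0
  show ?case by (simp add: shanks_def alt_def pent_def)
next
  case (Suc n)
  have *: "{- int (Suc n)..int (Suc n)} = insert (int (Suc n)) (insert (- int (Suc n)) {- int n..int n})"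
    by auto
  have "2 * int (pent (int (Suc n))) = 2 * int (Suc n * n + tri (Suc n))"
       "2 * int (pent (- int (Suc n))) = 2 * int (Suc n * Suc n + tri (Suc n))"
    unfolding pent_eq using tri_int[of "Suc n"] by (simp_all add: algebra_simps del: tri_Suc)
  then have p: "pent (int (Suc n)) = Suc n * n + tri (Suc n)"
       "pent (- int (Suc n)) = Suc n * Suc n + tri (Suc n)"
    unfolding of_nat_eq_iff mult_cancel_left by simp_all
  have alt: "fps_const (alt (int (Suc n))) = (- 1 :: int fps) ^ Suc n"
    by (simp add: alt_def minus_one_power_iff flip: fps_const_neg)
  show ?case
    unfolding * by (simp add: Suc.IH shanks_Suc p alt_minus alt algebra_simps del: tri_Suc of_nat_Suc power_Suc)
qed

theorem pentagonal: "euler = gser UNIV pent alt"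
proof (rule fps_eqI_rcong_X_power)
  fix n
  have "[gser UNIV pent alt \<simeq> shanks n] (modulo (fps_X ^ Suc n))"
    unfolding shanks_eq
  proof (rule gser_rcong_X_power)
    fix k assume "k \<in> UNIV - {- int n..int n}"
    then show "Suc n \<le> pent k" using pent_ge[of k] by auto
  qed (auto intro: fin_fibres_pent)
  also have "[shanks n \<simeq> (\<Sum>s\<le>n. if s = 0 then qfac n else 0)] (modulo (fps_X ^ Suc n))"
    unfolding shanks_def
  proof (rule rcong_sum)
    fix s assume s: "s \<in> {..n}"
    show "[(- 1) ^ s * qfac_quot n s * fps_X ^ (s * n + tri s) \<simeq> (if s = 0 then qfac n else 0)]
        (modulo (fps_X ^ Suc n))"
    proof (cases s)
      case (Suc r)
      have "Suc n \<le> s * n + tri s" by (simp add: Suc)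
      then show ?thesis
        using Suc unfolding rcong_def by (auto intro!: dvd_mult le_imp_power_dvd)
    qed (simp add: qfac_quot_0)
  qed
  also have "(\<Sum>s\<le>n. if s = 0 then qfac n else 0) = qfac n"
    by simp
  also note rcong_sym[OF euler_rcong_qfac]
  finally show "[euler \<simeq> gser UNIV pent alt] (modulo (fps_X ^ Suc n))"
    by (rule rcong_sym)
qed

section \<open>Jacobi's identity for the cube of Euler's product\<close>

text \<open>
  The Gaussian binomial coefficients, by Pascal's rule: this avoids division in the ring.
\<close>
fun qbin :: "'a::comm_ring_1 \<Rightarrow> nat \<Rightarrow> nat \<Rightarrow> 'a" where
  "qbin q n 0 = 1"
| "qbin q 0 (Suc k) = 0"
| "qbin q (Suc n) (Suc k) = qbin q n k + q ^ Suc k * qbin q n (Suc k)"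

lemma qbin_eq_0: "n < k \<Longrightarrow> qbin q n k = 0"
  by (induction q n k rule: qbin.induct) auto

text \<open>
  Pulling out the first factor leaves the product for \<open>z q\<close>, to which the induction hypothesis
  applies.  The homogeneous form in \<open>y\<close> and \<open>z\<close> makes room for negative powers of \<open>q\<close>: they can be
  cleared by taking \<open>y\<close> to be a power of \<open>q\<close>.
\<close>
lemma q_binomial:
  fixes q y z :: "'a::comm_ring_1"
  shows "(\<Prod>j<n. y + z * q ^ j) = (\<Sum>k\<le>n. qbin q n k * q ^ (k choose 2) * z ^ k * y ^ (n - k))"
proof (induction n arbitrary: z)
  case (Suc n)
  define c where "c k = qbin q n k * q ^ (Suc k choose 2) * z ^ k" for k
  have choose: "Suc k choose 2 = (k choose 2) + k" for k
    by (simp add: numeral_2_eq_2)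
  have "(\<Prod>j<Suc n. y + z * q ^ j) = (y + z) * (\<Prod>j<n. y + (z * q) * q ^ j)"
    by (subst prod.lessThan_Suc_shift) (simp add: mult_ac)
  also have "(\<Prod>j<n. y + (z * q) * q ^ j) = (\<Sum>k\<le>n. c k * y ^ (n - k))"
    unfolding Suc.IH by (intro sum.cong) (simp_all add: c_def choose power_add power_mult_distrib mult_ac)
  also have "(y + z) * \<dots> = (\<Sum>k\<le>n. c k * y ^ (Suc n - k)) + (\<Sum>k\<le>n. c k * z * y ^ (n - k))"
    unfolding distrib_right[of y z "\<Sum>k\<le>n. c k * y ^ (n - k)"] unfolding sum_distrib_left
    by (intro arg_cong2[where f = "(+)"] sum.cong refl) (simp_all add: Suc_diff_le mult_ac)
  also have "(\<Sum>k\<le>n. c k * y ^ (Suc n - k)) = (\<Sum>k\<le>Suc n. c k * y ^ (Suc n - k))"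
    by (simp add: c_def qbin_eq_0)
  also have "\<dots> = y ^ Suc n + (\<Sum>k\<le>n. c (Suc k) * y ^ (n - k))"
    by (subst sum.atMost_Suc_shift) (simp add: c_def numeral_2_eq_2)
  also have "\<dots> + (\<Sum>k\<le>n. c k * z * y ^ (n - k)) =
      y ^ Suc n + (\<Sum>k\<le>n. (c (Suc k) + c k * z) * y ^ (n - k))"
    by (simp add: sum.distrib distrib_right)
  also have "\<dots> = y ^ Suc n + (\<Sum>k\<le>n. qbin q (Suc n) (Suc k) * q ^ (Suc k choose 2) * z ^ Suc k * y ^ (n - k))"
    by (intro arg_cong2[where f = "(+)"] sum.cong refl)
       (simp add: c_def choose[of "Suc _"] power_add algebra_simps)
  also have "\<dots> = (\<Sum>k\<le>Suc n. qbin q (Suc n) k * q ^ (k choose 2) * z ^ k * y ^ (Suc n - k))"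
    by (subst sum.atMost_Suc_shift) (simp add: numeral_2_eq_2)
  finally show ?case .
qed (simp add: numeral_2_eq_2)

lemma qbin_qfac: "k \<le> n \<Longrightarrow> qbin fps_X n k * (qfac k * qfac (n - k)) = qfac n"
proof (induction n arbitrary: k)
  case (Suc n)
  show ?case
  proof (cases k)
    case (Suc j)
    then have j: "j \<le> n" using Suc.prems by simp
    let ?X = "fps_X :: int fps"
    have "qbin ?X n (Suc j) * (qfac (Suc j) * qfac (n - j)) = qfac n * (1 - ?X ^ (n - j))"
    proof (cases "j = n")
      case False
      then obtain i where i: "n - j = Suc i" "n - Suc j = i"
        using j by (metis Suc_diff_Suc le_neq_implies_less)
      show ?thesis
        using Suc.IH[of "Suc j"] False j unfolding i qfac_Suc[of i] by (simp add: mult_ac)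
    qed (simp add: qbin_eq_0)
    moreover have "qbin ?X n j * (qfac (Suc j) * qfac (n - j)) = qfac n * (1 - ?X ^ Suc j)"
      using Suc.IH[OF j] unfolding qfac_Suc[of j] by (simp add: mult_ac flip: Suc.IH[OF j])
    ultimately have "(qbin ?X n j + ?X ^ Suc j * qbin ?X n (Suc j)) * (qfac (Suc j) * qfac (n - j)) =
        qfac n * (1 - ?X ^ Suc j) + ?X ^ Suc j * (qfac n * (1 - ?X ^ (n - j)))"
      by (simp only: distrib_right mult.assoc)
    also have "\<dots> = qfac n * (1 - ?X ^ (Suc j + (n - j)))"
      unfolding power_add by (simp add: algebra_simps)
    also have "\<dots> = qfac (Suc n)"
      using j by (simp add: qfac_Suc)
    finally show ?thesis
      using Suc j by simp
  qed simp
qed simp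

lemma qfac_nonzero [simp]: "qfac n \<noteq> 0"
  using qfac_nth_0[of n] by (auto simp del: qfac_nth_0)

lemma qbin_sym:
  assumes "k \<le> n"
  shows "qbin (fps_X :: int fps) n (n - k) = qbin fps_X n k"
proof -
  have "qbin fps_X n (n - k) * (qfac k * qfac (n - k)) = qbin fps_X n k * (qfac k * qfac (n - k))"
    using qbin_qfac[of k n] qbin_qfac[of "n - k" n] assms by (simp add: mult_ac)
  then show ?thesis by simp
qed

lemma choose_2_int: "2 * int (k choose 2) = int k * (int k - 1)"
  by (induction k) (auto simp: numeral_2_eq_2 algebra_simps)

text \<open>
  The \<open>q\<close>-binomial theorem for \<open>2 n + 1\<close> factors with \<open>y = X^n\<close> and \<open>z = - w\<close> is a finite form of the
  triple product identity.  Both sides share a power of \<open>X\<close>; after it is cancelled, the terms with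
  indices \<open>n - j\<close> and \<open>n + 1 + j\<close> have the same exponent and combine to a multiple of
  \<open>1 - w^(2 j + 1)\<close>.  The factor \<open>1 - w\<close> stays on both sides because the
  identity is wanted at \<open>w = 1\<close>, where it cannot be cancelled directly.
\<close>
lemma finite_jacobi_triple:
  fixes w :: "int fps"
  shows "(\<Prod>j<n. fps_X ^ (n - j) - w) * (\<Prod>i=1..n. 1 - w * fps_X ^ i) * (1 - w) =
    (\<Sum>j\<le>n. qbin fps_X (2 * n + 1) (n - j) * fps_X ^ tri j * (- 1) ^ (n - j) * w ^ (n - j) *
       (\<Sum>i<2 * j + 1. w ^ i)) * (1 - w)" (is "?P * ?Q * _ = ?S * _")
proof -
  let ?X = "fps_X :: int fps" and ?N = "2 * n + 1"
  \<comment> \<open>the power of \<open>X\<close> shared by both sides\<close>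
  define c where "c = (\<Sum>j<n. j) + n * (n + 1)"
  have "(\<Prod>j<?N. ?X ^ n + (- w) * ?X ^ j) =
      (\<Prod>j<n. ?X ^ n - w * ?X ^ j) * (\<Prod>j\<in>{n..<n + (n + 1)}. ?X ^ n - w * ?X ^ j)"
  proof -
    have "{..<?N} = {..<n} \<union> {n..<n + (n + 1)}" by auto
    then show ?thesis
      using prod.union_disjoint[of "{..<n}" "{n..<n + (n + 1)}" "\<lambda>j. ?X ^ n - w * ?X ^ j"]
      by (simp only: ivl_disj_int finite_lessThan finite_atLeastLessThan mult_minus_left
          diff_conv_add_uminus)
  qed
  also have "(\<Prod>j\<in>{n..<n + (n + 1)}. ?X ^ n - w * ?X ^ j) = (\<Prod>i\<in>{0..<n + 1}. ?X ^ n - w * ?X ^ (i + n))"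
    using prod.shift_bounds_nat_ivl[of "\<lambda>j. ?X ^ n - w * ?X ^ j" 0 n "n + 1"] by (simp add: add.commute)
  also have "\<dots> = (\<Prod>i\<in>{0..<n + 1}. ?X ^ n * (1 - w * ?X ^ i))"
    by (intro prod.cong) (simp_all add: power_add algebra_simps)
  also have "\<dots> = ?X ^ (n * (n + 1)) * ((1 - w) * ?Q)"
  proof -
    have "{0..<n + 1} = insert 0 {1..n}" by auto
    then have "(\<Prod>i\<in>{0..<n + 1}. 1 - w * ?X ^ i) = (1 - w) * ?Q" by simp
    then show ?thesis
      by (simp only: prod.distrib prod_constant card_atLeastLessThan diff_zero power_mult)
  qed
  also have "(\<Prod>j<n. ?X ^ n - w * ?X ^ j) = (\<Prod>j<n. ?X ^ j * (?X ^ (n - j) - w))"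
    by (intro prod.cong) (simp_all add: right_diff_distrib mult.commute flip: power_add)
  also have "\<dots> = ?X ^ (\<Sum>j<n. j) * ?P"
    by (simp add: prod.distrib power_sum)
  finally have lhs: "(\<Prod>j<?N. ?X ^ n + (- w) * ?X ^ j) = ?X ^ c * (?P * ?Q * (1 - w))"
    by (simp add: c_def power_add mult_ac)
  define t where "t k = qbin ?X ?N k * ?X ^ (k choose 2) * (- w) ^ k * (?X ^ n) ^ (?N - k)" for k
  have "2 * int (\<Sum>j<m. j) = int m * (int m - 1)" for m
    by (induction m) (auto simp: algebra_simps)
  then have c_eq: "2 * int c = int n * (int n - 1) + 2 * int n * (int n + 1)"
    by (simp add: c_def algebra_simps)
  have exps: "((n - j) choose 2) + n * (?N - (n - j)) = c + tri j"
             "((n + 1 + j) choose 2) + n * (?N - (n + 1 + j)) = c + tri j" if "j \<le> n" for j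
  proof -
    have "n = (n - j) + j" using that by simp
    then obtain m where m: "n = m + j" by blast
    then have eqs: "n - j = m" "?N - m = m + 2 * j + 1" "n + 1 + j = m + 2 * j + 1"
      "?N - (m + 2 * j + 1) = m" by auto
    have "2 * int ((m choose 2) + n * (m + 2 * j + 1)) = 2 * int (c + tri j)"
         "2 * int (((m + 2 * j + 1) choose 2) + n * m) = 2 * int (c + tri j)"
      using choose_2_int[of m] choose_2_int[of "m + 2 * j + 1"] c_eq tri_int[of j]
      unfolding m by (simp_all add: algebra_simps)
    then show "((n - j) choose 2) + n * (?N - (n - j)) = c + tri j"
      "((n + 1 + j) choose 2) + n * (?N - (n + 1 + j)) = c + tri j"
      unfolding eqs of_nat_eq_iff mult_cancel_left by simp_all
  qed
  have "(\<Prod>j<?N. ?X ^ n + (- w) * ?X ^ j) = (\<Sum>k\<le>?N. t k)"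
    unfolding q_binomial t_def by simp
  also have "{..?N} = (\<lambda>j. n - j) ` {..n} \<union> (\<lambda>j. n + 1 + j) ` {..n}"
  proof -
    have "k \<in> (\<lambda>j. n - j) ` {..n} \<union> (\<lambda>j. n + 1 + j) ` {..n}" if "k \<le> ?N" for k
    proof (cases "k \<le> n")
      case True
      then show ?thesis by (intro UnI1 image_eqI[of _ _ "n - k"]) auto
    next
      case False
      then show ?thesis using that by (intro UnI2 image_eqI[of _ _ "k - n - 1"]) auto
    qed
    then show ?thesis by auto
  qed
  also have "(\<Sum>k\<in>\<dots>. t k) = (\<Sum>k\<in>(\<lambda>j. n - j) ` {..n}. t k) + (\<Sum>k\<in>(\<lambda>j. n + 1 + j) ` {..n}. t k)"
    by (rule sum.union_disjoint) auto
  also have "\<dots> = (\<Sum>j\<le>n. t (n - j) + t (n + 1 + j))"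
    by (subst (1 2) sum.reindex) (auto simp: inj_on_def sum.distrib)
  also have "\<dots> = (\<Sum>j\<le>n. ?X ^ c * (qbin ?X ?N (n - j) * ?X ^ tri j * (- 1) ^ (n - j) * w ^ (n - j) *
       ((\<Sum>i<2 * j + 1. w ^ i) * (1 - w))))"
  proof (rule sum.cong)
    fix j assume "j \<in> {..n}"
    then have j: "j \<le> n" by simp
    have sym: "qbin ?X ?N (n + 1 + j) = qbin ?X ?N (n - j)"
      using qbin_sym[of "n - j" ?N] j by (simp add: algebra_simps)
    have "n + 1 + j = (n - j) + (2 * j + 1)" using j by simp
    then have w: "(- w) ^ (n + 1 + j) = - ((- w) ^ (n - j) * w ^ (2 * j + 1))"
      by (simp only: power_add) (simp add: power_mult)
    have "t (n - j) = qbin ?X ?N (n - j) * (- w) ^ (n - j) * ?X ^ (((n - j) choose 2) + n * (?N - (n - j)))"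
      by (simp add: t_def power_add power_mult mult_ac)
    moreover have "t (n + 1 + j) = qbin ?X ?N (n + 1 + j) * (- w) ^ (n + 1 + j) *
        ?X ^ (((n + 1 + j) choose 2) + n * (?N - (n + 1 + j)))"
      unfolding t_def power_add power_mult by (simp only: mult_ac)
    ultimately have "t (n - j) + t (n + 1 + j) =
        ?X ^ (c + tri j) * (qbin ?X ?N (n - j) * ((- w) ^ (n - j) * (1 - w ^ (2 * j + 1))))"
      unfolding exps[OF j] sym w by (simp add: algebra_simps)
    also have "1 - w ^ (2 * j + 1) = (\<Sum>i<2 * j + 1. w ^ i) * (1 - w)"
      by (subst one_diff_power_eq) (rule mult.commute)
    also have "(- w) ^ (n - j) = (- 1) ^ (n - j) * w ^ (n - j)"
      by (rule power_minus)
    finally show "t (n - j) + t (n + 1 + j) = ?X ^ c * (qbin ?X ?N (n - j) * ?X ^ tri j * (- 1) ^ (n - j) *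
        w ^ (n - j) * ((\<Sum>i<2 * j + 1. w ^ i) * (1 - w)))"
      by (simp only: power_add mult_ac)
  qed simp
  also have "\<dots> = ?X ^ c * (?S * (1 - w))"
    by (simp only: sum_distrib_left sum_distrib_right mult.assoc)
  finally have "?X ^ c * (?P * ?Q * (1 - w)) = ?X ^ c * (?S * (1 - w))"
    unfolding lhs .
  then show ?thesis by simp
qed


text \<open>
  This is the previous identity divided by \<open>1 - w\<close> and taken at \<open>w = 1\<close>.  The division is legitimate
  for \<open>w = 1 + X^(N + 1)\<close>, and this \<open>w\<close> may be replaced by 1 modulo \<open>X^(N + 1)\<close>; \<open>N\<close> is arbitrary.
\<close>
lemma finite_jacobi:
  "(\<Sum>j\<le>n. qbin fps_X (2 * n + 1) (n - j) * fps_X ^ tri j * (- 1) ^ (n - j) * of_nat (2 * j + 1)) =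
    (- 1) ^ n * qfac n ^ 2"
proof (rule fps_eqI_rcong_X_power)
  fix N
  let ?X = "fps_X :: int fps"
  \<comment> \<open>different from 1, but equal to 1 up to the precision considered\<close>
  define w where "w = 1 + ?X ^ Suc N"
  have w: "[w \<simeq> 1] (modulo (?X ^ Suc N))"
    by (simp add: w_def rcong_def)
  have "(1 - w) \<noteq> 0"
    by (simp add: w_def)
  then have eq: "(\<Prod>j<n. ?X ^ (n - j) - w) * (\<Prod>i=1..n. 1 - w * ?X ^ i) =
    (\<Sum>j\<le>n. qbin ?X (2 * n + 1) (n - j) * ?X ^ tri j * (- 1) ^ (n - j) * w ^ (n - j) *
       (\<Sum>i<2 * j + 1. w ^ i))"
    using finite_jacobi_triple[of n w] unfolding mult_cancel_right by blast
  have "[(\<Sum>j\<le>n. qbin ?X (2 * n + 1) (n - j) * ?X ^ tri j * (- 1) ^ (n - j) * 1 ^ (n - j) *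
       (\<Sum>i<2 * j + 1. 1 ^ i)) \<simeq>
     (\<Sum>j\<le>n. qbin ?X (2 * n + 1) (n - j) * ?X ^ tri j * (- 1) ^ (n - j) * w ^ (n - j) *
       (\<Sum>i<2 * j + 1. w ^ i))] (modulo (?X ^ Suc N))"
    by (intro rcong_sum rcong_mult rcong_power rcong_refl rcong_sym[OF w])
  also have "\<dots> = (\<Prod>j<n. ?X ^ (n - j) - w) * (\<Prod>i=1..n. 1 - w * ?X ^ i)"
    by (rule eq[symmetric])
  also have "[\<dots> \<simeq> (\<Prod>j<n. ?X ^ (n - j) - 1) * (\<Prod>i=1..n. 1 - 1 * ?X ^ i)] (modulo (?X ^ Suc N))"
    by (intro rcong_prod rcong_mult rcong_diff rcong_refl w)
  also have "(\<Prod>j<n. ?X ^ (n - j) - 1) = (\<Prod>i=1..n. ?X ^ i - 1)"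
    by (rule prod.reindex_bij_witness[of _ "\<lambda>i. n - i" "\<lambda>j. n - j"]) auto
  also have "\<dots> = (\<Prod>i=1..n. (- 1) * (1 - ?X ^ i))"
    by simp
  also have "\<dots> = (- 1) ^ n * qfac n"
    unfolding prod.distrib by (simp add: qfac_def)
  also have "(\<Prod>i=1..n. 1 - 1 * ?X ^ i) = qfac n"
    by (simp add: qfac_def)
  finally show "[(\<Sum>j\<le>n. qbin ?X (2 * n + 1) (n - j) * ?X ^ tri j * (- 1) ^ (n - j) * of_nat (2 * j + 1)) \<simeq>
    (- 1) ^ n * qfac n ^ 2] (modulo (?X ^ Suc N))"
    by (simp add: power2_eq_square mult_ac)
qed

lemma euler_unit: "euler dvd 1"
  by (rule fps_unit_int) simp

text \<open>
  A Gaussian binomial coefficient whose two lower entries are large is close to the reciprocal of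
  Euler's product.
\<close>
lemma qbin_euler_rcong:
  assumes "j \<le> n"
  shows "[qbin fps_X (2 * n + 1) (n - j) * euler \<simeq> 1] (modulo (fps_X ^ Suc (n - j)))"
proof (rule rcong_cancel_unit[OF _ euler_unit])
  let ?m = "fps_X ^ Suc (n - j) :: int fps"
  let ?b = "qbin fps_X (2 * n + 1) (n - j)"
  have "[euler * euler \<simeq> qfac (n - j) * qfac (2 * n + 1 - (n - j))] (modulo ?m)"
    by (rule rcong_mult; rule rcong_X_power_le[OF euler_rcong_qfac]; simp)
  then have "[?b * (euler * euler) \<simeq> ?b * (qfac (n - j) * qfac (2 * n + 1 - (n - j)))] (modulo ?m)"
    by (rule rcong_mult[OF rcong_refl])
  also have "?b * (qfac (n - j) * qfac (2 * n + 1 - (n - j))) = qfac (2 * n + 1)"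
    by (rule qbin_qfac) simp
  also have "[\<dots> \<simeq> euler] (modulo ?m)"
    by (rule rcong_sym, rule rcong_X_power_le[OF euler_rcong_qfac]) auto
  finally show "[?b * euler * euler \<simeq> 1 * euler] (modulo ?m)"
    by (simp add: mult_ac)
qed

lemma fin_fibres_tri: "fin_fibres A tri"
  unfolding fin_fibres_def
proof
  fix n
  have "{x \<in> A. tri x = n} \<subseteq> {..n}"
    using tri_ge by auto
  then show "finite {x \<in> A. tri x = n}"
    by (rule finite_subset) simp
qed

text \<open>
  Multiply the finite identity by \<open>euler\<close>.  The error in replacing a Gaussian binomial coefficient by
  its limit has order at least \<open>n - j + 1\<close>, and it comes with the factor \<open>X^(tri j)\<close> of order at
  least \<open>j\<close>, so the identity holds modulo \<open>X^(n + 1)\<close>.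
\<close>
theorem jacobi: "euler ^ 3 = gser UNIV tri (\<lambda>n. (- 1) ^ n * (2 * int n + 1))"
proof (rule fps_eqI_rcong_X_power)
  fix n
  let ?X = "fps_X :: int fps" and ?m = "fps_X ^ Suc n :: int fps"
  define a where "a j = fps_const ((- 1) ^ j * (2 * int j + 1))" for j
  have a: "a j = (- 1) ^ n * ((- 1) ^ (n - j) * of_nat (2 * j + 1))" if "j \<le> n" for j
  proof -
    have "(- 1 :: int) ^ j = (- 1) ^ n * (- 1) ^ (n - j)"
      using that by (auto simp: minus_one_power_iff)
    then have "a j = fps_const ((- 1) ^ n * ((- 1) ^ (n - j) * of_nat (2 * j + 1)))"
      by (simp add: a_def)
    also have "\<dots> = (- 1) ^ n * ((- 1) ^ (n - j) * of_nat (2 * j + 1))"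
      by (simp add: minus_one_power_iff fps_of_nat[symmetric] flip: fps_const_neg fps_const_mult)
    finally show ?thesis .
  qed
  have "[gser UNIV tri (\<lambda>n. (- 1) ^ n * (2 * int n + 1)) \<simeq> (\<Sum>j\<le>n. a j * ?X ^ tri j)] (modulo ?m)"
    unfolding a_def
  proof (rule gser_rcong_X_power)
    fix j assume "j \<in> UNIV - {..n}"
    then show "Suc n \<le> tri j" using tri_ge[of j] by auto
  qed (auto intro: fin_fibres_tri)
  also have "[(\<Sum>j\<le>n. a j * ?X ^ tri j) \<simeq>
      (\<Sum>j\<le>n. a j * (?X ^ tri j * (qbin ?X (2 * n + 1) (n - j) * euler)))] (modulo ?m)"
  proof (rule rcong_sum, rule rcong_mult[OF rcong_refl])
    fix j assume "j \<in> {..n}"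
    then have "[?X ^ tri j * (qbin ?X (2 * n + 1) (n - j) * euler) \<simeq> ?X ^ tri j * 1] (modulo ?m)"
      using tri_ge[of j] by (intro rcong_X_power_mult[OF qbin_euler_rcong]) auto
    then show "[?X ^ tri j \<simeq> ?X ^ tri j * (qbin ?X (2 * n + 1) (n - j) * euler)] (modulo ?m)"
      by (simp add: rcong_sym)
  qed
  also have "(\<Sum>j\<le>n. a j * (?X ^ tri j * (qbin ?X (2 * n + 1) (n - j) * euler))) =
      (- 1) ^ n * euler * (\<Sum>j\<le>n. qbin ?X (2 * n + 1) (n - j) * ?X ^ tri j * (- 1) ^ (n - j) * of_nat (2 * j + 1))"
    unfolding sum_distrib_left by (rule sum.cong) (simp_all only: a atMost_iff mult_ac)
  also have "\<dots> = ((- 1) ^ n * (- 1) ^ n) * (euler * qfac n ^ 2)"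
    unfolding finite_jacobi by (simp only: mult_ac)
  also have "\<dots> = euler * qfac n ^ 2"
    by (simp flip: power_mult_distrib)
  also have "[\<dots> \<simeq> euler * euler ^ 2] (modulo ?m)"
    by (intro rcong_mult rcong_refl rcong_power rcong_sym[OF euler_rcong_qfac])
  also have "euler * euler ^ 2 = euler ^ 3"
    by (simp add: power2_eq_square power3_eq_cube)
  finally show "[euler ^ 3 \<simeq> gser UNIV tri (\<lambda>n. (- 1) ^ n * (2 * int n + 1))] (modulo ?m)"
    by (rule rcong_sym)
qed


section \<open>The substitution of -q for q\<close>

definition fneg :: "int fps \<Rightarrow> int fps" where
  "fneg f = f oo (- fps_X)"

lemma fneg_nth [simp]: "fneg f $ n = (- 1) ^ n * f $ n"
  by (simp add: fneg_def fps_compose_uminus')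

lemma fneg_simps [simp]:
  "fneg (f + g) = fneg f + fneg g" "fneg (f - g) = fneg f - fneg g" "fneg 1 = 1"
  by (simp_all add: fneg_def fps_compose_add_distrib fps_compose_sub_distrib)

lemma fneg_mult [simp]: "fneg (f * g) = fneg f * fneg g"
  by (simp add: fneg_def fps_compose_mult_distrib)

lemma fneg_power [simp]: "fneg (f ^ n) = fneg f ^ n"
  by (induction n) auto

lemma fneg_X [simp]: "fneg fps_X = - fps_X"
  by (simp add: fneg_def)

lemma fneg_dil_even: "even k \<Longrightarrow> k > 0 \<Longrightarrow> fneg (dil k f) = dil k f"
  by (rule fps_ext) (auto simp: dil_nth)

lemma rcong_fneg: "[f \<simeq> g] (modulo (fps_X ^ N)) \<Longrightarrow> [fneg f \<simeq> fneg g] (modulo (fps_X ^ N))"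
  by (simp add: rcong_X_power_iff)

lemma rcong_dil_X_power:
  fixes f g :: "int fps"
  assumes "[f \<simeq> g] (modulo (fps_X ^ N))" "k > 0"
  shows "[dil k f \<simeq> dil k g] (modulo (fps_X ^ (k * N)))"
  using assms by (auto simp: rcong_X_power_iff dil_nth elim!: dvdE)

lemma qfac_fneg: "qfac (2 * n) * fneg (qfac (2 * n)) * dil 4 (qfac n) = dil 2 (qfac (2 * n)) * dil 2 (qfac n) ^ 2"
proof (induction n)
  case (Suc n)
  let ?X = "fps_X :: int fps"
  have *: "(1 - ?X ^ (2 * n + 1)) * (1 - ?X ^ (2 * n + 2)) * ((1 + ?X ^ (2 * n + 1)) * (1 - ?X ^ (2 * n + 2))) *
      (1 - ?X ^ (4 * (n + 1))) =
      (1 - ?X ^ (2 * (2 * n + 1))) * (1 - ?X ^ (2 * (2 * n + 2))) * (1 - ?X ^ (2 * (n + 1))) ^ 2"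
  proof -
    define a b where "a = ?X ^ (2 * n + 1)" and "b = ?X ^ (2 * n + 2)"
    have "?X ^ (4 * (n + 1)) = b ^ 2" "?X ^ (2 * (2 * n + 1)) = a ^ 2"
      "?X ^ (2 * (2 * n + 2)) = b ^ 2" "?X ^ (2 * (n + 1)) = b"
      unfolding a_def b_def power_mult[symmetric]
      by (rule arg_cong[where f = "\<lambda>k. ?X ^ k"], simp)+
    then show ?thesis
      unfolding a_def[symmetric] b_def[symmetric] by (simp add: power2_eq_square algebra_simps)
  qed
  have step: "qfac (2 * Suc n) = qfac (2 * n) * ((1 - ?X ^ (2 * n + 1)) * (1 - ?X ^ (2 * n + 2)))"
    by (simp add: qfac_Suc mult.assoc)
  have 1: "fneg (qfac (2 * Suc n)) = fneg (qfac (2 * n)) * ((1 + ?X ^ (2 * n + 1)) * (1 - ?X ^ (2 * n + 2)))"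
    unfolding step by simp
  have 2: "dil 4 (qfac (Suc n)) = dil 4 (qfac n) * (1 - ?X ^ (4 * (n + 1)))"
    unfolding qfac_Suc
    by (simp only: dil_mult dil_simps dil_power dil_X zero_less_numeral power_mult Suc_eq_plus1)
  have 3: "dil 2 (qfac (2 * Suc n)) =
      dil 2 (qfac (2 * n)) * ((1 - ?X ^ (2 * (2 * n + 1))) * (1 - ?X ^ (2 * (2 * n + 2))))"
    unfolding step
    by (simp only: dil_mult dil_simps dil_power dil_X zero_less_numeral power_mult)
  have 4: "dil 2 (qfac (Suc n)) = dil 2 (qfac n) * (1 - ?X ^ (2 * (n + 1)))"
    unfolding qfac_Suc
    by (simp only: dil_mult dil_simps dil_power dil_X zero_less_numeral power_mult Suc_eq_plus1)
  have "qfac (2 * Suc n) * fneg (qfac (2 * Suc n)) * dil 4 (qfac (Suc n)) =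
      (qfac (2 * n) * fneg (qfac (2 * n)) * dil 4 (qfac n)) *
      ((1 - ?X ^ (2 * n + 1)) * (1 - ?X ^ (2 * n + 2)) * ((1 + ?X ^ (2 * n + 1)) * (1 - ?X ^ (2 * n + 2))) *
        (1 - ?X ^ (4 * (n + 1))))"
    unfolding 1 2 unfolding step by (simp only: mult_ac)
  also have "\<dots> = (dil 2 (qfac (2 * n)) * dil 2 (qfac n) ^ 2) *
      ((1 - ?X ^ (2 * (2 * n + 1))) * (1 - ?X ^ (2 * (2 * n + 2))) * (1 - ?X ^ (2 * (n + 1))) ^ 2)"
    unfolding Suc.IH * ..
  also have "\<dots> = dil 2 (qfac (2 * Suc n)) * dil 2 (qfac (Suc n)) ^ 2"
    unfolding 3 4 power_mult_distrib by (simp only: mult_ac)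
  finally show ?case .
qed simp

text \<open>
  In \<open>E(q) E(-q)\<close> the factors with even index \<open>k\<close> are squared, while those with odd \<open>k\<close> combine to
  \<open>1 - q^(2 k)\<close>, that is, to the factors of \<open>E(q^2)\<close> with odd index.  These are the quotient of
  \<open>E(q^2)\<close> by \<open>E(q^4)\<close>.
\<close>
theorem euler_fneg: "euler * fneg euler * dil 4 euler = dil 2 euler ^ 3"
proof (rule fps_eqI_rcong_X_power)
  fix n
  let ?m = "fps_X ^ Suc n :: int fps"
  have e: "[euler \<simeq> qfac (2 * n)] (modulo ?m)"
    by (rule rcong_X_power_le[OF euler_rcong_qfac]) simp
  have d: "[dil k euler \<simeq> dil k (qfac m)] (modulo ?m)" if "k > 0" "m \<ge> n" for k m
    by (rule rcong_X_power_le[OF rcong_dil_X_power[OF euler_rcong_qfac that(1)]])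
       (use that mult_le_mono[of 1 k "Suc n" "Suc m"] in simp)
  have "[euler * fneg euler * dil 4 euler \<simeq> qfac (2 * n) * fneg (qfac (2 * n)) * dil 4 (qfac n)] (modulo ?m)"
    by (intro rcong_mult rcong_fneg e d) auto
  also have "qfac (2 * n) * fneg (qfac (2 * n)) * dil 4 (qfac n) = dil 2 (qfac (2 * n)) * dil 2 (qfac n) ^ 2"
    by (rule qfac_fneg)
  also have "[\<dots> \<simeq> dil 2 euler * dil 2 euler ^ 2] (modulo ?m)"
    by (intro rcong_mult rcong_power rcong_sym[OF d]) auto
  also have "dil 2 euler * dil 2 euler ^ 2 = dil 2 euler ^ 3"
    by (simp add: power2_eq_square power3_eq_cube)
  finally show "[euler * fneg euler * dil 4 euler \<simeq> dil 2 euler ^ 3] (modulo ?m)" .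
qed

section \<open>From the unit disc to formal power series\<close>

definition cfps :: "int fps \<Rightarrow> complex fps" where
  "cfps f = Abs_fps (\<lambda>n. of_int (f $ n))"

lemma cfps_nth [simp]: "cfps f $ n = of_int (f $ n)"
  by (simp add: cfps_def)

lemma cfps_1 [simp]: "cfps 1 = 1"
  by (simp add: fps_eq_iff)

lemma cfps_mult [simp]: "cfps (f * g) = cfps f * cfps g"
  by (simp add: fps_eq_iff fps_mult_nth)

lemma cfps_diff [simp]: "cfps (f - g) = cfps f - cfps g"
  by (simp add: fps_eq_iff)

lemma cfps_power [simp]: "cfps (f ^ n) = cfps f ^ n"
  by (induction n) auto

lemma cfps_X [simp]: "cfps fps_X = fps_X"
  by (simp add: fps_eq_iff fps_X_def)

lemma cfps_prod [simp]: "cfps (prod f A) = (\<Prod>x\<in>A. cfps (f x))"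
  by (induction A rule: infinite_finite_induct) auto

lemma cfps_inject [simp]: "cfps f = cfps g \<longleftrightarrow> f = g"
  by (simp add: fps_eq_iff)

text \<open>
  The Taylor coefficients at 0 of the locally uniform limit are the limits of those of the partial
  products, which are eventually constant.
\<close>
lemma qpoch_has_fps_expansion:
  assumes m: "m > 0"
  shows "(\<lambda>q. qpoch (q ^ m) (q ^ m)) has_fps_expansion cfps (dil m euler)"
proof -
  let ?g = "\<lambda>q. qpoch (q ^ m) (q ^ m)"
  let ?f = "\<lambda>N q::complex. \<Prod>k<N. 1 - q ^ m * (q ^ m) ^ k"
  have f_exp: "?f N has_fps_expansion cfps (dil m (qfac N))" for N
  proof -
    have "?f N has_fps_expansion (\<Prod>k<N. 1 - fps_X ^ m * (fps_X ^ m) ^ k)"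
      by (intro fps_expansion_intros)
    also have "(\<Prod>k<N. 1 - fps_X ^ m * (fps_X ^ m) ^ k) = cfps (\<Prod>k<N. 1 - fps_X ^ m * (fps_X ^ m) ^ k)"
      by simp
    also have "(\<Prod>k<N. 1 - fps_X ^ m * (fps_X ^ m) ^ k) = dil m (qfac N)"
      using m unfolding qfac_def
      by (simp add: dil_prod prod.atLeast1_atMost_eq)
    finally show ?thesis .
  qed
  have ul: "uniform_limit (cball 0 (1/2)) ?f ?g sequentially"
    by (rule uniform_limit_qpoch[OF m]) auto
  have hol_f: "?f N holomorphic_on A" for N A
    by (intro holomorphic_intros)
  have hol: "?g holomorphic_on ball 0 (1/2)"
    by (rule holomorphic_uniform_limit[OF _ ul])
       (auto intro!: always_eventually hol_f continuous_intros)
  have g_exp: "?g has_fps_expansion fps_expansion ?g 0"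
    by (rule has_fps_expansion_fps_expansion[OF _ _ hol]) auto
  have "fps_expansion ?g 0 = cfps (dil m euler)"
  proof (rule fps_ext)
    fix n
    have "(\<lambda>N. (deriv ^^ n) (?f N) 0) \<longlonglongrightarrow> (deriv ^^ n) ?g 0"
      by (rule higher_deriv_complex_uniform_limit[OF uniform_limit_on_subset[OF ul, of "ball 0 (1/2)"]])
         (auto intro!: always_eventually hol_f)
    then have "(\<lambda>N. (deriv ^^ n) (?f N) 0 / fact n) \<longlonglongrightarrow> (deriv ^^ n) ?g 0 / fact n"
      by (intro tendsto_intros) auto
    moreover have "(\<lambda>N. (deriv ^^ n) (?f N) 0 / fact n) \<longlonglongrightarrow> cfps (dil m euler) $ n"
    proof (rule tendsto_eventually, rule eventually_mono[OF eventually_ge_at_top[of n]])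
      fix N assume "N \<ge> n"
      have "(deriv ^^ n) (?f N) 0 / fact n = cfps (dil m (qfac N)) $ n"
        by (rule fps_nth_fps_expansion[OF f_exp, symmetric])
      also have "\<dots> = cfps (dil m euler) $ n"
        using euler_rcong_qfac[of N] m le_trans[OF div_le_dividend[of n m] \<open>N \<ge> n\<close>]
        by (auto simp: rcong_X_power_iff dil_nth less_Suc_eq_le simp del: power_Suc)
      finally show "(deriv ^^ n) (?f N) 0 / fact n = cfps (dil m euler) $ n" .
    qed
    ultimately have "(deriv ^^ n) ?g 0 / fact n = cfps (dil m euler) $ n"
      by (rule LIMSEQ_unique)
    then show "fps_expansion ?g 0 $ n = cfps (dil m euler) $ n"
      by (simp add: fps_expansion_def)
  qed
  with g_exp show ?thesis by simp
qed

definition p33_fps :: "int fps" where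
  "p33_fps = Abs_fps (\<lambda>n. int (p33 n))"

theorem p33_fps_euler: "p33_fps * (euler ^ 3 * dil 3 euler ^ 3) = 1"
proof -
  let ?g = "\<lambda>q::complex. qpoch q q ^ 3 * qpoch (q ^ 3) (q ^ 3) ^ 3"
  have unit_disc: "eventually (\<lambda>q::complex. q \<in> ball 0 1) (nhds 0)"
    by (intro eventually_nhds_in_open) auto
  have "(\<lambda>q. 1 / ?g q) has_fps_expansion cfps p33_fps"
    by (intro has_fps_expansionI eventually_mono[OF unit_disc])
       (auto simp: p33_fps_def intro!: p33_sums)
  moreover have "?g has_fps_expansion cfps euler ^ 3 * cfps (dil 3 euler) ^ 3"
    using qpoch_has_fps_expansion[of 1] qpoch_has_fps_expansion[of 3]
    by (intro fps_expansion_intros) auto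
  ultimately have "(\<lambda>q. 1 / ?g q * ?g q) has_fps_expansion
      cfps p33_fps * (cfps euler ^ 3 * cfps (dil 3 euler) ^ 3)"
    by (rule has_fps_expansion_mult)
  also have "?this \<longleftrightarrow> (\<lambda>_. 1) has_fps_expansion
      cfps p33_fps * (cfps euler ^ 3 * cfps (dil 3 euler) ^ 3)"
  proof (intro has_fps_expansion_cong refl eventually_mono[OF unit_disc])
    fix q :: complex assume "q \<in> ball 0 1"
    then have "qpoch q q \<noteq> 0" "qpoch (q ^ 3) (q ^ 3) \<noteq> 0"
      using qpoch_power_nonzero[of q 1] qpoch_power_nonzero[of q 3] by auto
    then show "1 / ?g q * ?g q = 1" by simp
  qed
  finally have "cfps (p33_fps * (euler ^ 3 * dil 3 euler ^ 3)) = cfps 1"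
    using fps_expansion_unique_complex[OF _ has_fps_expansion_1] by simp
  then show ?thesis
    unfolding cfps_inject .
qed

section \<open>Jacobi's identity over the integers and its 3-dissection\<close>

lemma triz_eqI: "a * (a - 1) = 2 * int m \<Longrightarrow> triz a = m"
  using triz_eq[of a] by linarith

lemma triz_reflect: "triz (1 - a) = triz a"
  by (rule triz_eqI) (use triz_eq[of a] in \<open>simp add: algebra_simps\<close>)

lemma triz_of_nat: "triz (int n + 1) = tri n" "triz (- int n) = tri n"
  by (rule triz_eqI, use tri_int[of n] in \<open>simp add: algebra_simps\<close>)+

lemma int_eq_nat_halves:
  "(UNIV :: int set) = range (\<lambda>n. int n + 1) \<union> range (\<lambda>n. - int n)"
  "range (\<lambda>n. int n + 1) \<inter> range (\<lambda>n. - int n) = {}"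
proof -
  have "k \<in> range (\<lambda>n. int n + 1) \<union> range (\<lambda>n. - int n)" for k
  proof (cases "k > 0")
    case True
    then show ?thesis by (intro UnI1 image_eqI[of _ _ "nat (k - 1)"]) auto
  next
    case False
    then show ?thesis by (intro UnI2 image_eqI[of _ _ "nat (- k)"]) auto
  qed
  then show "(UNIV :: int set) = range (\<lambda>n. int n + 1) \<union> range (\<lambda>n. - int n)"
    by blast
qed auto

lemma gser_triz_nat:
  "gser UNIV triz w = gser UNIV tri (\<lambda>n. w (int n + 1) + w (- int n))"
proof -
  have "gser UNIV triz w = gser (range (\<lambda>n. int n + 1)) triz w + gser (range (\<lambda>n. - int n)) triz w"
    using gser_Un_disjoint[OF fin_fibres_triz int_eq_nat_halves(2), of w]
    unfolding int_eq_nat_halves(1)[symmetric] .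
  also have "gser (range (\<lambda>n. int n + 1)) triz w = gser UNIV tri (\<lambda>n. w (int n + 1))"
    by (subst gser_reindex[where h = "\<lambda>n. int n + 1" and B = UNIV])
       (simp_all add: bij_betw_def inj_on_def triz_of_nat)
  also have "gser (range (\<lambda>n. - int n)) triz w = gser UNIV tri (\<lambda>n. w (- int n))"
    by (subst gser_reindex[where h = "\<lambda>n. - int n" and B = UNIV])
       (simp_all add: bij_betw_def inj_on_def triz_of_nat)
  finally show ?thesis
    by (simp add: gser_add)
qed

lemma alt_of_nat: "alt (int n) = (- 1) ^ n"
  by (simp add: alt_def minus_one_power_iff)

text \<open>
  The indices \<open>n + 1\<close> and \<open>- n\<close> have the same triangular number, and their weights add up to the
  coefficient \<open>2 n + 1\<close> up to sign.
\<close>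
lemma gser_triz_jacobi: "gser UNIV triz (\<lambda>c. alt c * c) = - (euler ^ 3)"
  unfolding gser_triz_nat jacobi gser_minus[symmetric]
  by (rule gser_cong) (auto simp: alt_add alt_of_nat algebra_simps, simp add: alt_def)

lemma bij_reflect: "bij_betw (\<lambda>a::int. 1 - a) UNIV UNIV"
  by (rule bij_betw_byWitness[where f' = "\<lambda>a. 1 - a"]) auto

text \<open>
  The reflection of \<open>a\<close> to \<open>1 - a\<close> preserves the exponent and reverses the sign.
\<close>
lemma gser_triz_alt: "gser UNIV triz alt = 0"
  by (rule gser_eq_0_involution[OF bij_reflect]) (auto simp: triz_reflect alt_def)

lemma euler_eq_pent_minus: "euler = gser UNIV (\<lambda>k. pent (- k)) alt"
  unfolding pentagonal
  by (subst gser_reindex[where h = uminus and B = UNIV])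
     (auto intro: bij_betw_byWitness[where f' = uminus])

definition res3 :: "int \<Rightarrow> int set" where
  "res3 r = {a. a mod 3 = r}"

text \<open>
  The class of 1 is parametrized with a minus sign so that the exponents on the classes of 0 and 1
  become the same multiple of a pentagonal number.
\<close>
lemma bij_res3:
  "bij_betw (\<lambda>k. 3 * k) UNIV (res3 0)"
  "bij_betw (\<lambda>k. 1 - 3 * k) UNIV (res3 1)"
  "bij_betw (\<lambda>k. 3 * k - 1) UNIV (res3 2)"
proof -
  show "bij_betw (\<lambda>k. 3 * k) UNIV (res3 0)"
    by (rule bij_betw_byWitness[where f' = "\<lambda>a. a div 3"]) (auto simp: res3_def)
  show "bij_betw (\<lambda>k. 1 - 3 * k) UNIV (res3 1)"
    by (rule bij_betw_byWitness[where f' = "\<lambda>a. (1 - a) div 3"])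
       (simp_all add: res3_def image_subset_iff; presburger)+
  show "bij_betw (\<lambda>k. 3 * k - 1) UNIV (res3 2)"
    by (rule bij_betw_byWitness[where f' = "\<lambda>a. (a + 1) div 3"])
       (simp_all add: res3_def image_subset_iff; presburger)+
qed

lemma gser_split3:
  assumes "fin_fibres A e"
  shows "gser A e w = gser {x \<in> A. g x mod 3 = (0::int)} e w + gser {x \<in> A. g x mod 3 = 1} e w +
    gser {x \<in> A. g x mod 3 = 2} e w"
proof -
  let ?A = "\<lambda>r. {x \<in> A. g x mod 3 = r}"
  have A: "A = (?A 0 \<union> ?A 1) \<union> ?A 2"
  proof -
    have "x mod 3 = 0 \<or> x mod 3 = 1 \<or> x mod 3 = 2" for x :: int by presburger
    then show ?thesis by blast
  qed
  have "gser A e w = gser (?A 0 \<union> ?A 1) e w + gser (?A 2) e w"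
    by (subst (1) A, rule gser_Un_disjoint) (use assms A in auto)
  also have "gser (?A 0 \<union> ?A 1) e w = gser (?A 0) e w + gser (?A 1) e w"
    by (rule gser_Un_disjoint) (auto intro: fin_fibres_subset[OF assms])
  finally show ?thesis .
qed

lemma gser_triz_split3:
  "gser UNIV triz w = gser (res3 0) triz w + gser (res3 1) triz w + gser (res3 2) triz w"
  using gser_split3[OF fin_fibres_triz, of UNIV w "\<lambda>x. x"] by (simp add: res3_def)

lemma triz_res3:
  "triz (3 * k) = 3 * pent k" "triz (1 - 3 * k) = 3 * pent k" "triz (3 * j - 1) = 1 + 9 * triz j"
  by (rule triz_eqI; use pent_eq[of k] triz_eq[of j] in \<open>simp add: algebra_simps\<close>)+

lemma alt_res3:
  "alt (3 * k) = alt k" "alt (1 - 3 * k) = - alt k" "alt (3 * k - 1) = - alt k"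
  by (auto simp: alt_def)

lemma gser_res3:
  "gser (res3 0) triz w = dil 3 (gser UNIV pent (\<lambda>k. w (3 * k)))"
  "gser (res3 1) triz w = dil 3 (gser UNIV pent (\<lambda>k. w (1 - 3 * k)))"
  "gser (res3 2) triz w = fps_X * dil 9 (gser UNIV triz (\<lambda>k. w (3 * k - 1)))"
  using gser_X_power[of 1 UNIV "\<lambda>x. 9 * triz x" "\<lambda>k. w (3 * k - 1)"]
  by (simp_all add: gser_reindex[OF bij_res3(1)] gser_reindex[OF bij_res3(2)]
      gser_reindex[OF bij_res3(3)] triz_res3 gser_dil)

lemma gser_res3_alt:
  "gser (res3 0) triz alt = dil 3 euler"
  "gser (res3 1) triz alt = - dil 3 euler"
  "gser (res3 2) triz alt = 0"
  by (simp_all add: gser_res3 alt_res3 gser_minus gser_triz_alt pentagonal[symmetric])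

definition jacobi_part :: "int fps" where
  "jacobi_part = gser UNIV pent (\<lambda>k. alt k * (1 - 6 * k))"

text \<open>
  On the classes of 0 and 1 modulo 3 the triangular numbers are multiples of 3.  On the class of 2 they
  are \<open>1 + 9 t\<close> with \<open>t\<close> again triangular, and since the alternating sum without weight vanishes, the
  weight \<open>3 j - 1\<close> there counts as \<open>3 j\<close>: this part is Jacobi's series once more.
\<close>
theorem euler_cube_dissection:
  "euler ^ 3 = dil 3 jacobi_part - 3 * fps_X * dil 9 (euler ^ 3)"
proof -
  have "- (euler ^ 3) = dil 3 (gser UNIV pent (\<lambda>k. alt k * (3 * k)) + gser UNIV pent (\<lambda>k. - (alt k * (1 - 3 * k))))
      + fps_X * dil 9 (gser UNIV triz (\<lambda>j. - (alt j * (3 * j - 1))))"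
    using gser_triz_split3[of "\<lambda>c. alt c * c"]
    unfolding gser_triz_jacobi gser_res3 alt_res3 by simp
  also have "gser UNIV pent (\<lambda>k. alt k * (3 * k)) + gser UNIV pent (\<lambda>k. - (alt k * (1 - 3 * k))) = - jacobi_part"
    unfolding jacobi_part_def gser_add[symmetric] gser_minus[symmetric]
    by (rule gser_cong) (simp_all add: algebra_simps)
  also have "gser UNIV triz (\<lambda>j. - (alt j * (3 * j - 1))) = gser UNIV triz (\<lambda>j. alt j - 3 * (alt j * j))"
    by (rule gser_cong) (simp_all add: algebra_simps)
  also have "\<dots> = 3 * euler ^ 3"
    unfolding gser_diff gser_cmult gser_triz_alt gser_triz_jacobi by simp
  finally have "- (euler ^ 3) = - dil 3 jacobi_part + 3 * fps_X * dil 9 (euler ^ 3)"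
    by (simp add: mult_ac)
  then have "- (- (euler ^ 3)) = - (- dil 3 jacobi_part + 3 * fps_X * dil 9 (euler ^ 3))"
    by (rule arg_cong)
  then show ?thesis
    by (simp only: minus_minus minus_add_distrib diff_conv_add_uminus)
qed

text \<open>
  The weights \<open>1 - 6 k\<close> are odd, so modulo 2 this is the pentagonal number theorem.
\<close>
lemma jacobi_part_rcong: "[jacobi_part \<simeq> euler] (modulo 2)"
  unfolding jacobi_part_def pentagonal by (rule gser_rcong) (simp add: algebra_simps)

lemma jacobi_part_0: "jacobi_part $ 0 = 1"
  using arg_cong[OF euler_cube_dissection, of "\<lambda>f. fps_nth f 0"] by (simp add: mult.assoc numeral_fps_const fps_power_zeroth)

section \<open>Theta functions and the form x^2 + 3 y^2\<close>

definition psi :: "int fps" where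
  "psi = gser UNIV tri (\<lambda>_. 1)"

definition phi :: "int fps" where
  "phi = gser UNIV (\<lambda>k. nat (k ^ 2)) (\<lambda>_. 1)"

lemma euler_cube_rcong_psi: "[euler ^ 3 \<simeq> psi] (modulo 4)"
  unfolding jacobi psi_def
proof (rule gser_rcong)
  fix n :: nat
  show "4 dvd (- 1) ^ n * (2 * int n + 1) - 1"
    by (cases "even n") (auto elim!: evenE oddE)
qed

lemma gser_triz_1: "gser UNIV triz (\<lambda>_. 1) = 2 * psi"
  unfolding gser_triz_nat psi_def by (simp flip: gser_cmult)

lemma fin_fibres_square: "fin_fibres A (\<lambda>k::int. nat (k ^ 2))"
proof (rule fin_fibres_int)
  fix k :: int
  have "\<bar>k\<bar> * 1 \<le> \<bar>k\<bar> * \<bar>k\<bar>" by (cases "k = 0") (simp, intro mult_left_mono, auto)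
  then show "\<bar>k\<bar> \<le> int (nat (k ^ 2)) + 1"
    by (simp add: power2_eq_square flip: abs_mult)
qed

lemma fin_fibres_scale:
  assumes "fin_fibres A e" "k > 0"
  shows "fin_fibres A (\<lambda>x. k * e x)"
  unfolding fin_fibres_def
proof
  fix n
  have "{x \<in> A. k * e x = n} \<subseteq> {x \<in> A. e x = n div k}"
    using assms(2) by auto
  moreover have "finite {x \<in> A. e x = n div k}"
    using assms(1) by (simp add: fin_fibres_def)
  ultimately show "finite {x \<in> A. k * e x = n}"
    by (rule finite_subset)
qed

lemma gser_dil_mult:
  assumes "fin_fibres A e" "fin_fibres B f" "j > 0" "k > 0"
  shows "dil j (gser A e w) * dil k (gser B f v) =
    gser (A \<times> B) (\<lambda>(x, y). j * e x + k * f y) (\<lambda>(x, y). w x * v y)"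
  using assms by (simp add: gser_dil gser_mult fin_fibres_scale)

text \<open>
  Four times the left-hand side counts pairs of integers \<open>(a, b)\<close> by \<open>triz a + 3 triz b\<close>, which is
  \<open>(x^2 + 3 y^2 - 4) / 8\<close> for the odd numbers \<open>x = 2 a - 1\<close> and \<open>y = 2 b - 1\<close>.  Replacing \<open>y\<close> by \<open>- y\<close>
  reduces to \<open>a - b\<close> even.  There \<open>x^2 + 3 y^2 = 4 (u^2 + 3 v^2)\<close> with the integers
  \<open>u = (x + 3 y) / 4\<close> and \<open>v = (x - y) / 4\<close> of different parity, and the two summands on the right
  belong to \<open>v\<close> even and \<open>v\<close> odd.
\<close>
lemma psi_dissection: "psi * dil 3 psi = dil 2 (dil 3 phi * dil 2 psi) + fps_X * dil 2 (phi * dil 6 psi)"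
proof -
  let ?e = "\<lambda>(a, b). triz a + 3 * triz b" and ?w = "\<lambda>_::int \<times> int. 1::int"
  let ?U = "UNIV :: (int \<times> int) set"
  let ?A = "{(a, b). (a - b) mod 4 = (0::int)}" and ?B = "{(a, b). (a - b) mod 4 = (2::int)}"
    and ?C = "{(a, b). odd (a - b :: int)}"
  have prod: "dil j (gser UNIV triz (\<lambda>_. 1)) * dil k (gser UNIV triz (\<lambda>_. 1)) =
      gser (UNIV \<times> UNIV) (\<lambda>(a, b). j * triz a + k * triz b) ?w" if "j > 0" "k > 0" for j k
    using gser_dil_mult[OF fin_fibres_triz fin_fibres_triz that, of UNIV "\<lambda>_. 1" UNIV "\<lambda>_. 1"]
    by (simp add: case_prod_unfold)
  have prod': "dil j phi * dil k (gser UNIV triz (\<lambda>_. 1)) =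
      gser (UNIV \<times> UNIV) (\<lambda>(a, b). j * nat (a ^ 2) + k * triz b) ?w" if "j > 0" "k > 0" for j k
    using gser_dil_mult[OF fin_fibres_square fin_fibres_triz that, of UNIV "\<lambda>_. 1" UNIV "\<lambda>_. 1"]
    by (simp add: phi_def case_prod_unfold)
  have fin: "fin_fibres A ?e" for A
    by (rule fin_fibres_subset[OF fin_fibres_Times[OF fin_fibres_triz[of UNIV]
            fin_fibres_scale[OF fin_fibres_triz[of UNIV]]]]) auto
  have "gser UNIV triz (\<lambda>_. 1) * dil 3 (gser UNIV triz (\<lambda>_. 1)) = gser ?U ?e ?w"
    using prod[of 1 3] by simp
  then have "4 * (psi * dil 3 psi) = gser ?U ?e ?w"
    by (simp add: gser_triz_1)
  also have "\<dots> = gser (?A \<union> ?B) ?e ?w + gser ?C ?e ?w"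
  proof -
    have cases: "x mod 4 = 0 \<or> x mod 4 = 2 \<or> odd x" for x :: int by presburger
    have excl: "\<not> (x mod 4 = 0 \<and> odd x)" "\<not> (x mod 4 = 2 \<and> odd x)" for x :: int
      by presburger+
    have "(a, b) \<in> (?A \<union> ?B) \<union> ?C" "(a, b) \<notin> (?A \<union> ?B) \<inter> ?C" for a b
      using cases[of "a - b"] excl[of "a - b"] unfolding Un_iff Int_iff mem_Collect_eq case_prod_conv
      by argo+
    then have "?U = (?A \<union> ?B) \<union> ?C" "(?A \<union> ?B) \<inter> ?C = {}"
      by (auto simp only: set_eq_iff split_paired_All UNIV_I empty_iff)
    then show ?thesis using gser_Un_disjoint[OF fin, of "?A \<union> ?B" ?C ?w] by simp
  qed
  also have "gser ?C ?e ?w = gser (?A \<union> ?B) ?e ?w"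
  proof (subst gser_reindex[where h = "\<lambda>(a, b). (a, 1 - b)" and B = "?A \<union> ?B"])
    show "bij_betw (\<lambda>(a, b). (a, 1 - b)) (?A \<union> ?B) ?C"
      by (rule bij_betw_byWitness[where f' = "\<lambda>(a, b). (a, 1 - b)"]) (auto, presburger+)
    show "gser (?A \<union> ?B) (\<lambda>x. ?e (case x of (a, b) \<Rightarrow> (a, 1 - b))) (\<lambda>_. 1) = gser (?A \<union> ?B) ?e ?w"
      by (rule gser_cong) (auto simp: triz_reflect)
  qed
  also have "gser (?A \<union> ?B) ?e ?w = gser ?A ?e ?w + gser ?B ?e ?w"
    by (rule gser_Un_disjoint[OF fin]) auto
  \<comment> \<open>here \<open>v = 2 w\<close> and \<open>u = 2 c - 1\<close>\<close>
  also have "gser ?A ?e ?w = 2 * dil 2 (dil 3 phi * dil 2 psi)"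
  proof -
    have exps: "triz (c + 3 * w) + 3 * triz (c - w) = 6 * nat (w ^ 2) + 4 * triz c" for c w
    proof -
      have "2 * int (triz (c + 3 * w) + 3 * triz (c - w)) = 2 * int (6 * nat (w ^ 2) + 4 * triz c)"
        using triz_eq[of "c + 3 * w"] triz_eq[of "c - w"] triz_eq[of c]
        by (simp add: algebra_simps power2_eq_square)
      then show ?thesis unfolding mult_cancel_left of_nat_eq_iff by simp
    qed
    have "bij_betw (\<lambda>(w, c). (c + 3 * w, c - w)) (UNIV \<times> UNIV) ?A"
    proof (rule bij_betw_byWitness[where f' = "\<lambda>(a, b). ((a - b) div 4, b + (a - b) div 4)"])
      have "(c + 3 * w - (c - w)) mod 4 = 0" for w c :: int by presburger
      then show "(\<lambda>(w, c). (c + 3 * w, c - w)) ` (UNIV \<times> UNIV) \<subseteq> ?A" by auto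
      have "4 * ((a - b) div 4) = a - b" if "(a - b) mod 4 = 0" for a b :: int
        using that by presburger
      then show "\<forall>x \<in> ?A. (case case x of (a, b) \<Rightarrow> ((a - b) div 4, b + (a - b) div 4) of
          (w, c) \<Rightarrow> (c + 3 * w, c - w)) = x" by force
    qed auto
    from gser_reindex[OF this]
    have "gser ?A ?e ?w = gser (UNIV \<times> UNIV) (\<lambda>(w, c). 6 * nat (w ^ 2) + 4 * triz c) ?w"
      by (simp add: case_prod_unfold exps)
    also have "\<dots> = dil 6 phi * dil 4 (gser UNIV triz (\<lambda>_. 1))"
      by (rule prod'[symmetric]) auto
    finally show ?thesis by (simp add: gser_triz_1)
  qed
  \<comment> \<open>here \<open>v = 2 c - 1\<close> and \<open>u = 2 w\<close>\<close>
  also have "gser ?B ?e ?w = 2 * (fps_X * dil 2 (phi * dil 6 psi))"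
  proof -
    have exps: "triz (w + 3 * c - 1) + 3 * triz (w - c + 1) = 1 + (2 * nat (w ^ 2) + 12 * triz c)" for c w
    proof -
      have "2 * int (triz (w + 3 * c - 1) + 3 * triz (w - c + 1)) =
          2 * int (1 + (2 * nat (w ^ 2) + 12 * triz c))"
        using triz_eq[of "w + 3 * c - 1"] triz_eq[of "w - c + 1"] triz_eq[of c]
        by (simp add: algebra_simps power2_eq_square)
      then show ?thesis unfolding mult_cancel_left of_nat_eq_iff by simp
    qed
    have "bij_betw (\<lambda>(w, c). (w + 3 * c - 1, w - c + 1)) (UNIV \<times> UNIV) ?B"
    proof (rule bij_betw_byWitness[where f' = "\<lambda>(a, b). (b - 1 + (a - b + 2) div 4, (a - b + 2) div 4)"])
      have "(w + 3 * c - 1 - (w - c + 1)) mod 4 = 2" for w c :: int by presburger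
      then show "(\<lambda>(w, c). (w + 3 * c - 1, w - c + 1)) ` (UNIV \<times> UNIV) \<subseteq> ?B" by auto
      have "4 * ((a - b + 2) div 4) = a - b + 2" if "(a - b) mod 4 = 2" for a b :: int
        using that by presburger
      then show "\<forall>x \<in> ?B. (case case x of (a, b) \<Rightarrow> (b - 1 + (a - b + 2) div 4, (a - b + 2) div 4) of
          (w, c) \<Rightarrow> (w + 3 * c - 1, w - c + 1)) = x" by force
    qed auto
    from gser_reindex[OF this]
    have "gser ?B ?e ?w = gser (UNIV \<times> UNIV) (\<lambda>(w, c). 1 + (2 * nat (w ^ 2) + 12 * triz c)) ?w"
      by (simp add: case_prod_unfold exps)
    also have "\<dots> = fps_X ^ 1 * gser (UNIV \<times> UNIV) (\<lambda>(w, c). 2 * nat (w ^ 2) + 12 * triz c) ?w"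
      unfolding gser_X_power by (simp add: case_prod_unfold)
    also have "gser (UNIV \<times> UNIV) (\<lambda>(w, c). 2 * nat (w ^ 2) + 12 * triz c) ?w =
        dil 2 phi * dil 12 (gser UNIV triz (\<lambda>_. 1))"
      by (rule prod'[symmetric]) auto
    finally show ?thesis by (simp add: gser_triz_1)
  qed
  finally have "4 * (psi * dil 3 psi) = 4 * (dil 2 (dil 3 phi * dil 2 psi) + fps_X * dil 2 (phi * dil 6 psi))"
    by (simp add: algebra_simps)
  moreover have "(4 :: int fps) \<noteq> 0"
    by (simp add: numeral_fps_const)
  ultimately show ?thesis
    unfolding mult_cancel_left by blast
qed


section \<open>A lattice sum for the squares\<close>

definition triz3 :: "int \<times> int \<times> int \<Rightarrow> nat" where
  "triz3 = (\<lambda>(a, b, c). triz a + triz b + triz c)"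

text \<open>
  Exchanging \<open>b\<close> and \<open>c\<close> shows that the weight \<open>c\<close> would give half of the difference computed below.  The
  weight \<open>c - b\<close> has the advantage of being invariant under translation along \<open>(1, 1, 1)\<close>.
\<close>
definition wt :: "int \<times> int \<times> int \<Rightarrow> int" where
  "wt = (\<lambda>(a, b, c). alt (a + b + c) * (c - b))"

lemma triz3_nested: "triz3 = (\<lambda>(x, y). triz x + (case y of (x, y) \<Rightarrow> triz x + triz y))"
  by (auto simp: triz3_def fun_eq_iff)

lemma fin_fibres_triz3: "fin_fibres A triz3"
proof -
  have "fin_fibres (UNIV \<times> UNIV \<times> UNIV) triz3"
    unfolding triz3_nested by (intro fin_fibres_Times fin_fibres_triz)
  then show ?thesis
    by (rule fin_fibres_subset) auto
qed

lemma gser_triz3_prod: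
  "gser (A \<times> B \<times> C) triz3 (\<lambda>(a, b, c). f a * (g b * h c)) =
    gser A triz f * (gser B triz g * gser C triz h)"
proof -
  have "gser A triz f * (gser B triz g * gser C triz h) =
      gser (A \<times> B \<times> C) triz3 (\<lambda>(x, y). f x * (case y of (x, y) \<Rightarrow> g x * h y))"
    unfolding triz3_nested gser_mult[OF fin_fibres_triz fin_fibres_triz]
    by (rule gser_mult) (intro fin_fibres_Times fin_fibres_triz)+
  also have "\<dots> = gser (A \<times> B \<times> C) triz3 (\<lambda>(a, b, c). f a * (g b * h c))"
    by (rule gser_cong) auto
  finally show ?thesis ..
qed

lemma gser_triz3_ab:
  "gser {(a, b, c). a mod 3 = b mod 3} triz3 (\<lambda>(a, b, c). f a * (g b * h c)) =
    (gser (res3 0) triz f * gser (res3 0) triz g + gser (res3 1) triz f * gser (res3 1) triz g +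
     gser (res3 2) triz f * gser (res3 2) triz g) * gser UNIV triz h"
proof -
  have *: "{x. (case x of (a, b, c) \<Rightarrow> a mod 3 = b mod 3) \<and> fst x mod 3 = r} = res3 r \<times> res3 r \<times> UNIV" for r
    by (auto simp: res3_def)
  show ?thesis
    by (subst gser_split3[OF fin_fibres_triz3, where g = fst]) (simp add: * gser_triz3_prod algebra_simps)
qed

lemma gser_triz3_ac:
  "gser {(a, b, c). a mod 3 = c mod 3} triz3 (\<lambda>(a, b, c). f a * (g b * h c)) =
    (gser (res3 0) triz f * gser (res3 0) triz h + gser (res3 1) triz f * gser (res3 1) triz h +
     gser (res3 2) triz f * gser (res3 2) triz h) * gser UNIV triz g"
proof -
  have *: "{x. (case x of (a, b, c) \<Rightarrow> a mod 3 = c mod 3) \<and> fst x mod 3 = r} = res3 r \<times> UNIV \<times> res3 r" for r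
    by (auto simp: res3_def)
  show ?thesis
    by (subst gser_split3[OF fin_fibres_triz3, where g = fst]) (simp add: * gser_triz3_prod algebra_simps)
qed

lemma wt_eq: "wt = (\<lambda>x. (case x of (a, b, c) \<Rightarrow> alt a * (alt b * (alt c * c))) -
    (case x of (a, b, c) \<Rightarrow> alt a * ((alt b * b) * alt c)))"
  by (auto simp: wt_def alt_add algebra_simps)

text \<open>
  The three coordinates separate on each residue class.  Whenever a free coordinate carries no
  weight, its alternating sum makes the contribution vanish; what is left are the squares of the
  sums over the classes of 0 and 1, each of which is \<open>E\<^sub>3\<close> up to sign, times Jacobi's series.
\<close>
lemma gser_wt_difference:
  "gser {(a, b, c). a mod 3 = b mod 3} triz3 wt - gser {(a, b, c). a mod 3 = c mod 3} triz3 wt =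
    - 4 * (euler ^ 3 * dil 3 euler ^ 2)"
  unfolding wt_eq gser_diff gser_triz3_ab gser_triz3_ac gser_res3_alt gser_triz_alt gser_triz_jacobi
  by (simp add: power2_eq_square algebra_simps)

definition shift3 :: "int \<times> (int \<times> int \<times> int) \<Rightarrow> int \<times> int \<times> int" where
  "shift3 = (\<lambda>(k, a, b, c). (a + k, b + k, c + k))"

definition tsum :: "int \<times> int \<times> int \<Rightarrow> int" where
  "tsum = (\<lambda>(a, b, c). a + b + c)"

text \<open>
  Every point with \<open>a + b + c\<close> congruent to \<open>j\<close> is a unique translate by \<open>(k, k, k)\<close> of a point with
  \<open>a + b + c = j\<close>.  For \<open>j = 1\<close> and \<open>j = 2\<close> the translation adds a pentagonal number depending only on
  \<open>k\<close> to the exponent and multiplies the weight by \<open>alt k\<close>, so that the pentagonal number theorem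
  yields the factor.
\<close>
lemma gser_shift3:
  assumes inv: "\<And>k x. shift3 (k, x) \<in> P \<longleftrightarrow> x \<in> P" and j: "j = 1 \<or> j = 2"
  shows "gser {x \<in> P. tsum x mod 3 = j} triz3 wt = euler * gser {x \<in> P. tsum x = j} triz3 wt"
proof -
  let ?P = "{x \<in> P. tsum x = j}"
  \<comment> \<open>for \<open>j = 2\<close> the translation by \<open>k\<close> produces the pentagonal number of \<open>- k\<close>\<close>
  define e where "e = (\<lambda>k. if j = 1 then pent k else pent (- k))"
  have euler: "euler = gser UNIV e alt"
    using j euler_eq_pent_minus pentagonal by (auto simp: e_def)
  have fin: "fin_fibres UNIV e"
  proof (rule fin_fibres_int)
    fix k show "\<bar>k\<bar> \<le> int (e k) + 1"
      using pent_ge[of k] pent_ge[of "- k"] by (auto simp: e_def)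
  qed
  have bij: "bij_betw shift3 (UNIV \<times> ?P) {x \<in> P. tsum x mod 3 = j}"
  proof (rule bij_betw_byWitness[where f' = "\<lambda>x. (tsum x div 3, shift3 (- (tsum x div 3), x))"])
    have tsum: "tsum (shift3 (k, x)) = tsum x + 3 * k" for k x
      by (cases x) (auto simp: tsum_def shift3_def)
    have shift: "shift3 (k, shift3 (l, x)) = shift3 (k + l, x)" "shift3 (0, x) = x" for k l x
      by (cases x; auto simp: shift3_def)+
    have div: "(j + 3 * k) div 3 = k" "(j + 3 * k) mod 3 = j" for k
      using j by auto
    show "\<forall>x \<in> UNIV \<times> ?P. (tsum (shift3 x) div 3, shift3 (- (tsum (shift3 x) div 3), shift3 x)) = x"
      by (auto simp: tsum shift div)
    show "\<forall>x \<in> {x \<in> P. tsum x mod 3 = j}. shift3 (tsum x div 3, shift3 (- (tsum x div 3), x)) = x"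
      by (auto simp: shift)
    show "shift3 ` (UNIV \<times> ?P) \<subseteq> {x \<in> P. tsum x mod 3 = j}"
    proof (rule image_subsetI)
      fix p :: "int \<times> int \<times> int \<times> int" assume "p \<in> UNIV \<times> ?P"
      then obtain k x where "p = (k, x)" "x \<in> P" "tsum x = j" by blast
      then show "shift3 p \<in> {x \<in> P. tsum x mod 3 = j}" using j by (auto simp: inv tsum)
    qed
    show "(\<lambda>x. (tsum x div 3, shift3 (- (tsum x div 3), x))) ` {x \<in> P. tsum x mod 3 = j} \<subseteq> UNIV \<times> ?P"
      by (auto simp: inv tsum minus_mult_div_eq_mod[symmetric])
  qed
  have exps: "triz3 (shift3 (k, x)) = e k + triz3 x" if "tsum x = j" for k x
  proof -
    obtain a b c where x: "x = (a, b, c)" by (cases x)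
    have c: "c = j - a - b" using that by (simp add: x tsum_def)
    have "2 * int (triz3 (shift3 (k, x))) = 2 * int (e k + triz3 x)"
      using triz_eq[of a] triz_eq[of b] triz_eq[of c] triz_eq[of "a + k"] triz_eq[of "b + k"]
        triz_eq[of "c + k"] pent_eq[of k] pent_eq[of "- k"] j
      by (auto simp: x triz3_def shift3_def e_def c algebra_simps)
    then show ?thesis unfolding mult_cancel_left of_nat_eq_iff by simp
  qed
  have weights: "wt (shift3 (k, x)) = alt k * wt x" for k x
    by (cases x) (auto simp: wt_def shift3_def alt_def)
  have "gser {x \<in> P. tsum x mod 3 = j} triz3 wt =
      gser (UNIV \<times> ?P) (\<lambda>(k, x). e k + triz3 x) (\<lambda>(k, x). alt k * wt x)"
    unfolding gser_reindex[OF bij] by (rule gser_cong) (auto simp: exps weights)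
  also have "\<dots> = euler * gser ?P triz3 wt"
    unfolding euler by (rule gser_mult[symmetric]) (auto intro: fin fin_fibres_triz3)
  finally show ?thesis .
qed

text \<open>
  The form is the norm from the ring generated by a cube root of unity, in which 5 is inert.
\<close>
lemma dvd_5_norm_form:
  fixes x y :: int
  assumes "5 dvd x ^ 2 + x * y + y ^ 2"
  shows "5 dvd y"
proof -
  define r s where "r = x mod 5" and "s = y mod 5"
  have "[r ^ 2 + r * s + s ^ 2 = x ^ 2 + x * y + y ^ 2] (mod 5)"
    by (intro cong_add cong_mult cong_pow) (simp_all add: r_def s_def cong_def)
  then have "(r ^ 2 + r * s + s ^ 2) mod 5 = (x ^ 2 + x * y + y ^ 2) mod 5"
    by (simp add: cong_def)
  then have "(r ^ 2 + r * s + s ^ 2) mod 5 = 0"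
    using assms by simp
  moreover have "r \<in> {0, 1, 2, 3, 4}" "s \<in> {0, 1, 2, 3, 4}"
    unfolding r_def s_def by (simp_all, presburger+)
  ultimately have "s = 0"
    by (elim insertE emptyE) (simp_all add: power2_eq_square)
  then show ?thesis
    by (simp add: s_def dvd_eq_mod_eq_0)
qed

text \<open>
  On the plane \<open>a + b + c = j\<close> the exponent \<open>n\<close> satisfies \<open>x^2 + x y + y^2 = 3 n + 1\<close> for \<open>x = a - b\<close> and
  \<open>y = b - c\<close>, which is divisible by 5 if \<open>n\<close> is 3 modulo 5.  Then every single weight is divisible
  by 5.
\<close>
lemma gser_slice_dvd_5:
  assumes j: "j = 1 \<or> j = 2" and n: "n mod 5 = 3"
  shows "5 dvd gser {x \<in> P. tsum x = j} triz3 wt $ n"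
  unfolding gser_nth
proof (rule dvd_sum)
  fix x assume x: "x \<in> {x. x \<in> {x \<in> P. tsum x = j} \<and> triz3 x = n}"
  obtain a b c where abc: "x = (a, b, c)" by (cases x)
  have a: "a = j - b - c" using x by (simp add: abc tsum_def)
  have "int n = int (triz a) + int (triz b) + int (triz c)"
    using x by (auto simp: abc triz3_def)
  then have "2 * ((a - b) ^ 2 + (a - b) * (b - c) + (b - c) ^ 2) = 2 * (3 * int n + 1)"
    using triz_eq[of a] triz_eq[of b] triz_eq[of c] j
    by (auto simp: a algebra_simps power2_eq_square)
  then have "(a - b) ^ 2 + (a - b) * (b - c) + (b - c) ^ 2 = 3 * int n + 1"
    by simp
  moreover have "5 dvd 3 * int n + 1"
    using n by presburger
  ultimately have "5 dvd (a - b) ^ 2 + (a - b) * (b - c) + (b - c) ^ 2"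
    by (rule ssubst)
  then have "5 dvd b - c"
    by (rule dvd_5_norm_form)
  then have "5 dvd c - b"
    by (simp add: dvd_diff_commute)
  then show "5 dvd wt x"
    by (simp add: abc wt_def)
qed

text \<open>
  In the difference of the two lattice sums the points with \<open>a + b + c\<close> divisible by 3 cancel, since
  for them \<open>a\<close> is congruent to \<open>b\<close> exactly if it is congruent to \<open>c\<close>.  The rest is divisible by \<open>E\<close>.
\<close>
theorem euler_square_dvd_5:
  assumes "n mod 5 = 3"
  shows "5 dvd (euler ^ 2 * dil 3 euler ^ 2) $ n"
proof -
  let ?P = "{(a, b, c). a mod 3 = (b::int) mod 3} :: (int \<times> int \<times> int) set"
  let ?Q = "{(a, b, c). a mod 3 = (c::int) mod 3} :: (int \<times> int \<times> int) set"
  let ?S = "\<lambda>P j. gser {x \<in> P. tsum x = j} triz3 wt"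
  have inv: "shift3 (k, x) \<in> ?P \<longleftrightarrow> x \<in> ?P" "shift3 (k, x) \<in> ?Q \<longleftrightarrow> x \<in> ?Q" for k x
    by (cases x; auto simp: shift3_def mod_eq_dvd_iff)+
  have zero: "{x \<in> ?P. tsum x mod 3 = 0} = {x \<in> ?Q. tsum x mod 3 = 0}"
  proof -
    have "3 dvd a - c" if "3 dvd a + b + c" "3 dvd a - b" for a b c :: int
    proof -
      have "3 dvd 3 * a - (a - b) - (a + b + c)"
        by (rule dvd_diff[OF dvd_diff[OF dvd_triv_left that(2)] that(1)])
      moreover have "3 * a - (a - b) - (a + b + c) = a - c" by simp
      ultimately show ?thesis by (simp only:)
    qed
    from this[of a b c for a b c] this[of a c b for a b c]
    have dvd: "3 dvd a - b \<longleftrightarrow> 3 dvd a - c" if "3 dvd a + b + c" for a b c :: int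
      using that by (auto simp: add_ac)
    have "(a, b, c) \<in> {x \<in> ?P. tsum x mod 3 = 0} \<longleftrightarrow> (a, b, c) \<in> {x \<in> ?Q. tsum x mod 3 = 0}" for a b c
      using dvd[of a b c] unfolding mem_Collect_eq case_prod_conv tsum_def mod_eq_dvd_iff dvd_eq_mod_eq_0[symmetric]
      by argo
    then show ?thesis
      by (simp only: set_eq_iff split_paired_All) blast
  qed
  have "- 4 * (euler ^ 3 * dil 3 euler ^ 2) = gser ?P triz3 wt - gser ?Q triz3 wt"
    by (rule gser_wt_difference[symmetric])
  also have "\<dots> = euler * (?S ?P 1 + ?S ?P 2 - ?S ?Q 1 - ?S ?Q 2)"
    unfolding gser_split3[OF fin_fibres_triz3, of ?P wt tsum] gser_split3[OF fin_fibres_triz3, of ?Q wt tsum]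
      zero gser_shift3[OF inv(1) disjI1[OF refl]] gser_shift3[OF inv(1) disjI2[OF refl]]
      gser_shift3[OF inv(2) disjI1[OF refl]] gser_shift3[OF inv(2) disjI2[OF refl]]
    by (simp add: algebra_simps)
  finally have "euler * (- 4 * (euler ^ 2 * dil 3 euler ^ 2)) = euler * (?S ?P 1 + ?S ?P 2 - ?S ?Q 1 - ?S ?Q 2)"
    by (simp add: power2_eq_square power3_eq_cube mult_ac)
  moreover have "euler \<noteq> 0"
    using euler_0 by (auto simp del: euler_0)
  ultimately have "- 4 * (euler ^ 2 * dil 3 euler ^ 2) = ?S ?P 1 + ?S ?P 2 - ?S ?Q 1 - ?S ?Q 2"
    unfolding mult_cancel_left by blast
  then have "(- 4 * (euler ^ 2 * dil 3 euler ^ 2)) $ n = (?S ?P 1 + ?S ?P 2 - ?S ?Q 1 - ?S ?Q 2) $ n"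
    by (rule arg_cong)
  also have "(- 4 * (euler ^ 2 * dil 3 euler ^ 2)) $ n = - 4 * (euler ^ 2 * dil 3 euler ^ 2) $ n"
    by (simp add: numeral_fps_const mult.assoc)
  finally have "- 4 * (euler ^ 2 * dil 3 euler ^ 2) $ n = (?S ?P 1 + ?S ?P 2 - ?S ?Q 1 - ?S ?Q 2) $ n" .
  moreover have "5 dvd (?S ?P 1 + ?S ?P 2 - ?S ?Q 1 - ?S ?Q 2) $ n"
    unfolding fps_add_nth fps_sub_nth
    by (intro dvd_add dvd_diff gser_slice_dvd_5 assms) auto
  ultimately have "5 dvd - 4 * (euler ^ 2 * dil 3 euler ^ 2) $ n"
    by simp
  then show ?thesis by presburger
qed

section \<open>Congruences modulo 3, 9, 27 and 5\<close>

lemma sec_one: "0 < r \<Longrightarrow> r < k \<Longrightarrow> sec k r 1 = 0"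
  using sec_dil(2)[of r k 1] by simp

lemma sec_X: "r < k \<Longrightarrow> k > 1 \<Longrightarrow> sec k r fps_X = (if r = 1 then 1 else 0 :: 'a::comm_ring_1 fps)"
proof (rule fps_ext)
  fix n assume "r < k" "k > 1"
  then have "k * n + r = 1 \<longleftrightarrow> n = 0 \<and> r = 1" by (cases n) auto
  then show "sec k r fps_X $ n = (if r = 1 then 1 else 0 :: 'a fps) $ n"
    by (auto simp: fps_X_def)
qed

lemma rcong_0_coeff:
  "[sec k r f \<simeq> 0] (modulo (numeral c)) \<Longrightarrow> numeral c dvd f $ (k * n + r)" for f :: "int fps"
  by (simp add: rcong_fps_iff)

lemma dil_euler_unit: "dil k euler dvd 1" "euler dvd 1"
  by (rule fps_unit_int, simp)+

lemma fps_unit_mult: "f dvd 1 \<Longrightarrow> g dvd 1 \<Longrightarrow> f * g dvd 1" for f g :: "int fps"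
  by (metis mult_dvd_mono mult_1)

lemma fps_unit_power: "f dvd 1 \<Longrightarrow> f ^ n dvd 1" for f :: "int fps"
  by (induction n) (auto intro: fps_unit_mult)

lemmas unit_intros = dil_euler_unit fps_unit_mult fps_unit_power

lemma fps_small_prime_power_rcong:
  fixes f :: "int fps"
  shows "[f ^ 2 \<simeq> dil 2 f] (modulo 2)" "[f ^ 3 \<simeq> dil 3 f] (modulo 3)" "[f ^ 5 \<simeq> dil 5 f] (modulo 5)"
  using fps_power_prime_rcong_dil[of 2 f] fps_power_prime_rcong_dil[of 3 f]
    fps_power_prime_rcong_dil[of 5 f] by simp_all

lemma cube_norm:
  fixes a x :: "'a::comm_ring_1"
  shows "(a - 3 * x) * (a ^ 2 + 3 * x * a + 9 * x ^ 2) = a ^ 3 - 27 * x ^ 3"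
  by (simp add: power2_eq_square power3_eq_cube algebra_simps)

text \<open>
  The norm of \<open>E^3\<close> from series in \<open>q\<close> to series in \<open>q^3\<close>, with \<open>q^3\<close> renamed to \<open>q\<close>; the cofactor is
  given in the following lemma.
\<close>
definition cube_norm_part :: "int fps" where
  "cube_norm_part = jacobi_part ^ 3 - 27 * fps_X * dil 3 euler ^ 9"

lemma euler_cube_inverse:
  "euler ^ 3 * (dil 3 (jacobi_part ^ 2) + fps_X * dil 3 (3 * jacobi_part * dil 3 euler ^ 3) +
      fps_X * (fps_X * dil 3 (9 * dil 3 euler ^ 6))) = dil 3 cube_norm_part"
proof -
  define a where "a = dil 3 jacobi_part"
  define x where "x = fps_X * dil 9 euler ^ 3"
  have e: "euler ^ 3 = a - 3 * x"
    using euler_cube_dissection by (simp add: a_def x_def mult.assoc)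
  have "dil 3 (jacobi_part ^ 2) + fps_X * dil 3 (3 * jacobi_part * dil 3 euler ^ 3) +
      fps_X * (fps_X * dil 3 (9 * dil 3 euler ^ 6)) = a ^ 2 + 3 * x * a + 9 * x ^ 2"
    by (simp add: a_def x_def power_mult_distrib power2_eq_square algebra_simps flip: power_mult power_add)
  moreover have "dil 3 cube_norm_part = a ^ 3 - 27 * x ^ 3"
    by (simp add: a_def x_def cube_norm_part_def power_mult_distrib mult_ac flip: power_mult)
  ultimately show ?thesis
    using cube_norm[of a x] by (simp add: e)
qed

lemma cube_norm_part_unit: "cube_norm_part dvd 1"
  by (rule fps_unit_int)
     (simp add: cube_norm_part_def fps_power_zeroth jacobi_part_0 mult.assoc numeral_fps_const)

text \<open>
  Modulo 3 the series is, up to an invertible series in \<open>q^3\<close>, equal to 1.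
\<close>
theorem p33_mod_3: "3 dvd p33_fps $ (3 * n + 1)"
proof -
  have "[p33_fps * dil 3 (euler * dil 3 euler) \<simeq> p33_fps * (euler ^ 3 * dil 3 euler ^ 3)] (modulo 3)"
    using rcong_sym[OF fps_small_prime_power_rcong(2)[of euler]] rcong_sym[OF fps_small_prime_power_rcong(2)[of "dil 3 euler"]]
    by (simp add: rcong_mult)
  then have "[sec 3 1 (p33_fps * dil 3 (euler * dil 3 euler)) \<simeq> sec 3 1 1] (modulo 3)"
    unfolding p33_fps_euler by (rule rcong_sec)
  then have "[sec 3 1 p33_fps * (euler * dil 3 euler) \<simeq> 0 * (euler * dil 3 euler)] (modulo 3)"
    by (simp add: sec_mult_dil sec_one del: dil_mult)
  then have "[sec 3 1 p33_fps \<simeq> 0] (modulo 3)"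
    by (rule rcong_cancel_unit) (intro unit_intros)
  then show ?thesis
    by (rule rcong_0_coeff)
qed

text \<open>
  Of the three terms of the cofactor only the last one has exponents congruent to 2 modulo 3.
\<close>
lemma sec_3_2_p33_fps:
  "sec 3 2 p33_fps * (cube_norm_part * euler ^ 3) = 9 * dil 3 (euler ^ 6)"
proof -
  let ?c = "dil 3 (jacobi_part ^ 2) + fps_X * dil 3 (3 * jacobi_part * dil 3 euler ^ 3) +
      fps_X * (fps_X * dil 3 (9 * dil 3 euler ^ 6))"
  have "p33_fps * dil 3 (cube_norm_part * euler ^ 3) = p33_fps * (euler ^ 3 * dil 3 euler ^ 3) * ?c"
    using euler_cube_inverse by (simp add: mult_ac)
  then have "p33_fps * dil 3 (cube_norm_part * euler ^ 3) = ?c"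
    unfolding p33_fps_euler by simp
  then have "sec 3 2 (p33_fps * dil 3 (cube_norm_part * euler ^ 3)) = sec 3 2 ?c"
    by (rule arg_cong)
  also have "sec 3 2 ?c = 9 * dil 3 euler ^ 6"
    by (simp add: sec_simps sec_X_mult numeral_2_eq_2 del: dil_mult dil_power)
  finally show ?thesis
    by (simp add: sec_mult_dil del: dil_mult)
qed

theorem p33_mod_9: "9 dvd p33_fps $ (3 * n + 2)"
proof -
  have "[sec 3 2 p33_fps * (cube_norm_part * euler ^ 3) \<simeq> 0 * (cube_norm_part * euler ^ 3)] (modulo 9)"
    unfolding sec_3_2_p33_fps by (simp add: rcong_def)
  then have "[sec 3 2 p33_fps \<simeq> 0] (modulo 9)"
    by (rule rcong_cancel_unit) (intro unit_intros cube_norm_part_unit)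
  then show ?thesis
    by (rule rcong_0_coeff)
qed

text \<open>
  By \<open>sec_3_2_p33_fps\<close> the coefficients along \<open>3 n + 2\<close> are 9 times those of a quotient of two series.  The
  numerator is a series in \<open>q^3\<close>, and the denominator is congruent to such a series modulo 3.
\<close>
theorem p33_mod_27:
  assumes "r = 1 \<or> r = 2"
  shows "27 dvd p33_fps $ (9 * n + (3 * r + 2))"
proof -
  \<comment> \<open>\<open>V\<close> is the reciprocal of the denominator\<close>
  obtain V where V: "cube_norm_part * euler ^ 3 * V = 1"
    using cube_norm_part_unit unit_intros by (metis dvdE fps_unit_mult)
  define q where "q = dil 3 (euler ^ 6) * V"
  have p: "sec 3 2 p33_fps = 9 * q"
  proof -
    have "sec 3 2 p33_fps = sec 3 2 p33_fps * (cube_norm_part * euler ^ 3) * V"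
      using V by (simp add: mult.assoc)
    then show ?thesis
      unfolding sec_3_2_p33_fps q_def by (simp add: mult.assoc)
  qed
  have "[cube_norm_part \<simeq> jacobi_part ^ 3 - 0] (modulo 3)"
    unfolding cube_norm_part_def
  proof (rule rcong_diff[OF rcong_refl])
    have "(27 :: int fps) = 3 * 9" by simp
    then have "(3 :: int fps) dvd 27" by (rule dvdI)
    then show "[27 * fps_X * dil 3 euler ^ 9 \<simeq> 0] (modulo 3)"
      by (simp add: rcong_def dvd_mult2)
  qed
  also have "[jacobi_part ^ 3 - 0 \<simeq> dil 3 jacobi_part] (modulo 3)"
    using fps_small_prime_power_rcong(2)[of jacobi_part] by simp
  finally have "[dil 3 (jacobi_part * euler) * q \<simeq> cube_norm_part * euler ^ 3 * q] (modulo 3)"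
    using fps_small_prime_power_rcong(2)[of euler] by (auto intro!: rcong_mult intro: rcong_sym)
  also have "cube_norm_part * euler ^ 3 * q = dil 3 (euler ^ 6)"
    using V by (simp add: q_def mult_ac)
  finally have "[sec 3 r (dil 3 (jacobi_part * euler) * q) \<simeq> sec 3 r (dil 3 (euler ^ 6))] (modulo 3)"
    by (rule rcong_sec)
  moreover have r: "0 < r" "r < 3"
    using assms by auto
  have "sec 3 r (dil 3 (jacobi_part * euler) * q) = sec 3 r q * (jacobi_part * euler)"
    using sec_dil_mult[OF r(2), of "jacobi_part * euler" q] by (simp only: mult.commute)
  moreover have "sec 3 r (dil 3 (euler ^ 6)) = 0"
    by (rule sec_dil(2)[OF r])
  ultimately have "[sec 3 r q * (jacobi_part * euler) \<simeq> 0 * (jacobi_part * euler)] (modulo 3)"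
    by simp
  then have "[sec 3 r q \<simeq> 0] (modulo 3)"
    by (rule rcong_cancel_unit) (intro unit_intros fps_unit_int jacobi_part_0)
  then have "3 dvd q $ (3 * n + r)"
    by (rule rcong_0_coeff)
  moreover have "p33_fps $ (9 * n + (3 * r + 2)) = 9 * q $ (3 * n + r)"
    using arg_cong[OF p, of "\<lambda>f. fps_nth f (3 * n + r)"]
    by (simp add: numeral_fps_const algebra_simps)
  ultimately show ?thesis
    by auto
qed

text \<open>
  The reciprocal of \<open>E^3 E\<^sub>3^3\<close> is \<open>E^2 E\<^sub>3^2\<close> divided by fifth powers.
\<close>
theorem p33_mod_5: "5 dvd p33_fps $ (5 * n + 3)"
proof -
  let ?e = "euler ^ 2 * dil 3 euler ^ 2"
  have "[p33_fps * dil 5 (euler * dil 3 euler) \<simeq> p33_fps * (euler ^ 5 * dil 3 euler ^ 5)] (modulo 5)"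
    using rcong_sym[OF fps_small_prime_power_rcong(3)[of euler]] rcong_sym[OF fps_small_prime_power_rcong(3)[of "dil 3 euler"]]
    by (simp add: rcong_mult)
  also have "p33_fps * (euler ^ 5 * dil 3 euler ^ 5) = p33_fps * (euler ^ 3 * dil 3 euler ^ 3) * ?e"
    by (simp add: mult_ac flip: power_add)
  also have "\<dots> = ?e"
    unfolding p33_fps_euler by simp
  finally have "[sec 5 3 (p33_fps * dil 5 (euler * dil 3 euler)) \<simeq> sec 5 3 ?e] (modulo 5)"
    by (rule rcong_sec)
  also have "[sec 5 3 ?e \<simeq> 0] (modulo 5)"
    by (simp add: rcong_fps_iff euler_square_dvd_5)
  finally have "[sec 5 3 p33_fps * (euler * dil 3 euler) \<simeq> 0 * (euler * dil 3 euler)] (modulo 5)"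
    by (simp add: sec_mult_dil del: dil_mult)
  then have "[sec 5 3 p33_fps \<simeq> 0] (modulo 5)"
    by (rule rcong_cancel_unit) (intro unit_intros)
  then show ?thesis
    by (rule rcong_0_coeff)
qed


section \<open>Congruences modulo 2\<close>

lemma phi_rcong_1: "[phi \<simeq> 1] (modulo 2)"
proof -
  let ?e = "\<lambda>k::int. nat (k ^ 2)" and ?w = "\<lambda>_::int. 1::int"
  have "phi = gser ({0} \<union> ({0<..} \<union> {..<0})) ?e ?w"
    unfolding phi_def by (rule arg_cong[where f = "\<lambda>A. gser A ?e ?w"]) auto
  also have "\<dots> = gser {0} ?e ?w + gser ({0<..} \<union> {..<0}) ?e ?w"
    by (rule gser_Un_disjoint[OF fin_fibres_square]) auto
  also have "gser ({0<..} \<union> {..<0}) ?e ?w = gser {0<..} ?e ?w + gser {..<0} ?e ?w"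
    by (rule gser_Un_disjoint[OF fin_fibres_square]) auto
  also have "gser {..<0} ?e ?w = gser {0<..} ?e ?w"
    by (subst gser_reindex[where h = uminus and B = "{0<..}"])
       (auto intro: bij_betw_byWitness[where f' = uminus])
  also have "gser {0} ?e ?w = 1"
    by (rule fps_ext) (auto simp: gser_nth conj_commute Collect_conv_if)
  finally have "phi = 1 + 2 * gser {0<..} ?e ?w"
    by simp
  then have "phi - 1 = 1 + 2 * gser {0<..} ?e ?w - 1"
    by (rule arg_cong)
  also have "\<dots> = 2 * gser {0<..} ?e ?w"
    by (rule add_diff_cancel_left')
  finally have "phi - 1 = 2 * gser {0<..} ?e ?w" .
  then show ?thesis
    unfolding rcong_def by (rule dvdI)
qed

lemma rcong_add_multiple: "[f \<simeq> f + m * g] (modulo m)"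
  by (simp add: rcong_def)

lemma two_dvd_four: "(2 :: int fps) dvd 4"
proof -
  have "(4 :: int fps) = 2 * 2" by simp
  then show ?thesis by (rule dvdI)
qed

lemma euler_cubes_rcong_4:
  "[euler ^ 3 * dil 3 euler ^ 3 \<simeq> dil 2 (dil 3 phi * dil 2 psi) + fps_X * dil 2 (phi * dil 6 psi)] (modulo 4)"
  unfolding psi_dissection[symmetric]
  using rcong_mult[OF euler_cube_rcong_psi rcong_dil[OF euler_cube_rcong_psi, of 3]] by simp

lemma euler_cubes_rcong_2:
  "[euler ^ 3 * dil 3 euler ^ 3 \<simeq> dil 4 (euler ^ 3) + fps_X * dil 12 (euler ^ 3)] (modulo 2)"
proof -
  have psi: "[psi \<simeq> euler ^ 3] (modulo 2)"
    by (rule rcong_sym[OF rcong_dvd_modulus[OF euler_cube_rcong_psi two_dvd_four]])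
  have "[euler ^ 3 * dil 3 euler ^ 3 \<simeq> dil 2 (dil 3 phi * dil 2 psi) + fps_X * dil 2 (phi * dil 6 psi)] (modulo 2)"
    by (rule rcong_dvd_modulus[OF euler_cubes_rcong_4 two_dvd_four])
  also have "[dil 2 (dil 3 phi * dil 2 psi) + fps_X * dil 2 (phi * dil 6 psi) \<simeq>
      dil 2 (dil 3 1 * dil 2 (euler ^ 3)) + fps_X * dil 2 (1 * dil 6 (euler ^ 3))] (modulo 2)"
    by (intro rcong_add rcong_mult rcong_dil phi_rcong_1 psi rcong_refl) auto
  finally show ?thesis by simp
qed

text \<open>
  With \<open>F = E^3 E\<^sub>3^3\<close> the reciprocal of \<open>F\<close> is \<open>F / F^2\<close>, and modulo 2 the denominator is a series in
  \<open>q^2\<close>.  So the 2-dissection of \<open>F\<close> is that of the reciprocal as well.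
\<close>
lemma even_odd_parts_rcong_2:
  "[sec 2 0 p33_fps * dil 3 euler ^ 3 \<simeq> euler ^ 3] (modulo 2)"
  "[sec 2 1 p33_fps * euler ^ 3 \<simeq> dil 3 euler ^ 3] (modulo 2)"
proof -
  define F where "F = euler ^ 3 * dil 3 euler ^ 3"
  have "[p33_fps * dil 2 F \<simeq> p33_fps * F ^ 2] (modulo 2)"
    by (rule rcong_mult[OF rcong_refl rcong_sym[OF fps_small_prime_power_rcong(1)]])
  also have "p33_fps * F ^ 2 = F"
    using p33_fps_euler by (simp add: F_def power2_eq_square flip: mult.assoc)
  also have "[F \<simeq> dil 2 (dil 2 euler ^ 3) + fps_X * dil 2 (dil 6 euler ^ 3)] (modulo 2)"
    using euler_cubes_rcong_2 by (simp add: F_def)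
  finally have *: "[p33_fps * dil 2 F \<simeq> dil 2 (dil 2 euler ^ 3) + fps_X * dil 2 (dil 6 euler ^ 3)] (modulo 2)" .
  have "[dil 2 euler ^ 3 \<simeq> (euler ^ 2) ^ 3] (modulo 2)"
    by (intro rcong_power rcong_sym[OF fps_small_prime_power_rcong(1)])
  then have 2: "[dil 2 euler ^ 3 \<simeq> euler ^ 3 * euler ^ 3] (modulo 2)"
    by (simp flip: power_mult power_add)
  have "[dil 3 (dil 2 euler ^ 3) \<simeq> dil 3 (euler ^ 3 * euler ^ 3)] (modulo 2)"
    by (rule rcong_dil[OF 2]) simp
  then have 6: "[dil 6 euler ^ 3 \<simeq> dil 3 euler ^ 3 * dil 3 euler ^ 3] (modulo 2)"
    by simp
  have "[sec 2 0 (p33_fps * dil 2 F) \<simeq> sec 2 0 (dil 2 (dil 2 euler ^ 3) + fps_X * dil 2 (dil 6 euler ^ 3))] (modulo 2)"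
    by (rule rcong_sec[OF *])
  then have "[sec 2 0 p33_fps * F \<simeq> dil 2 euler ^ 3] (modulo 2)"
    by (simp add: sec_mult_dil sec_simps sec_X_mult sec_X del: dil_mult dil_power)
  also note 2
  finally have "[sec 2 0 p33_fps * dil 3 euler ^ 3 * euler ^ 3 \<simeq> euler ^ 3 * euler ^ 3] (modulo 2)"
    by (simp add: F_def mult_ac)
  then show "[sec 2 0 p33_fps * dil 3 euler ^ 3 \<simeq> euler ^ 3] (modulo 2)"
    by (rule rcong_cancel_unit) (intro unit_intros)
  have "[sec 2 1 (p33_fps * dil 2 F) \<simeq> sec 2 1 (dil 2 (dil 2 euler ^ 3) + fps_X * dil 2 (dil 6 euler ^ 3))] (modulo 2)"
    by (rule rcong_sec[OF *])
  then have "[sec 2 1 p33_fps * F \<simeq> dil 6 euler ^ 3] (modulo 2)"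
    by (simp add: sec_mult_dil sec_simps sec_X_mult sec_X del: dil_mult dil_power)
  also note 6
  finally have "[sec 2 1 p33_fps * euler ^ 3 * dil 3 euler ^ 3 \<simeq> dil 3 euler ^ 3 * dil 3 euler ^ 3] (modulo 2)"
    by (simp add: F_def mult_ac)
  then show "[sec 2 1 p33_fps * euler ^ 3 \<simeq> dil 3 euler ^ 3] (modulo 2)"
    by (rule rcong_cancel_unit) (intro unit_intros)
qed

lemma sec_euler_cube: "sec 3 0 (euler ^ 3) = jacobi_part" "sec 3 2 (euler ^ 3) = 0"
proof -
  have "euler ^ 3 = dil 3 jacobi_part - fps_X * dil 3 (3 * dil 3 (euler ^ 3))"
  proof -
    have "dil 3 (3 * dil 3 (euler ^ 3)) = 3 * dil 9 (euler ^ 3)" by simp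
    then show ?thesis using euler_cube_dissection by (simp only: mult_ac)
  qed
  then have *: "sec 3 r (euler ^ 3) = sec 3 r (dil 3 jacobi_part - fps_X * dil 3 (3 * dil 3 (euler ^ 3)))" for r
    by (rule arg_cong)
  show "sec 3 0 (euler ^ 3) = jacobi_part" "sec 3 2 (euler ^ 3) = 0"
    unfolding * by (simp_all add: sec_simps sec_X_mult numeral_2_eq_2 del: dil_mult dil_power)
qed

text \<open>
  The even part is \<open>E^3 / E\<^sub>3^3\<close>.  Its exponents divisible by 3 form, with \<open>q^3\<close> renamed to \<open>q\<close>, a
  series congruent to \<open>E / E^3\<close>, which modulo 2 is a series in \<open>q^2\<close>.
\<close>
theorem p33_even_12n_6: "2 dvd p33_fps $ (12 * n + 6)"
proof -
  let ?p = "sec 3 0 (sec 2 0 p33_fps)"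
  have "[sec 3 0 (sec 2 0 p33_fps * dil 3 (euler ^ 3)) \<simeq> sec 3 0 (euler ^ 3)] (modulo 2)"
    using rcong_sec[OF even_odd_parts_rcong_2(1), of 3 0] by simp
  then have "[?p * euler ^ 3 \<simeq> jacobi_part] (modulo 2)"
    by (simp add: sec_mult_dil sec_euler_cube del: dil_mult dil_power)
  also note jacobi_part_rcong
  finally have "[?p * euler ^ 2 * euler \<simeq> 1 * euler] (modulo 2)"
    by (simp add: power2_eq_square power3_eq_cube mult_ac)
  then have "[?p * euler ^ 2 \<simeq> 1] (modulo 2)"
    by (rule rcong_cancel_unit) (intro unit_intros)
  then have "[?p * dil 2 euler \<simeq> 1] (modulo 2)"
    using rcong_trans[OF rcong_mult[OF rcong_refl rcong_sym[OF fps_small_prime_power_rcong(1)]]] by blast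
  then have "[sec 2 1 (?p * dil 2 euler) \<simeq> sec 2 1 1] (modulo 2)"
    by (rule rcong_sec)
  then have "[sec 2 1 ?p * euler \<simeq> 0 * euler] (modulo 2)"
    by (simp add: sec_mult_dil sec_one)
  then have "[sec 2 1 ?p \<simeq> 0] (modulo 2)"
    by (rule rcong_cancel_unit) (intro unit_intros)
  then have "[sec 12 6 p33_fps \<simeq> 0] (modulo 2)"
    by (simp add: sec_sec)
  then show ?thesis
    by (rule rcong_0_coeff)
qed

text \<open>
  Up to the factor \<open>E\<^sub>3^3\<close>, this is the 2-dissection of \<open>E^3 E\<^sub>3^3\<close> read backwards: the term
  \<open>q E\<^sub>3^12\<close> cancels the odd part and leaves \<open>E\<^sub>4^3\<close>.
\<close>
lemma cube_norm_part_rcong_2: "[cube_norm_part * dil 3 euler ^ 3 \<simeq> dil 4 euler ^ 3] (modulo 2)"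
proof -
  let ?N = "dil 3 euler"
  have four: "[f ^ 4 \<simeq> dil 4 f] (modulo 2)" for f :: "int fps"
  proof -
    have "[(f ^ 2) ^ 2 \<simeq> (dil 2 f) ^ 2] (modulo 2)"
      by (intro rcong_power fps_small_prime_power_rcong)
    also note fps_small_prime_power_rcong(1)[of "dil 2 f"]
    finally show ?thesis by (simp flip: power_mult)
  qed
  have "[(?N ^ 3) ^ 4 \<simeq> dil 4 (?N ^ 3)] (modulo 2)"
    by (rule four)
  then have N: "[?N ^ 12 \<simeq> dil 12 euler ^ 3] (modulo 2)"
    by (simp flip: power_mult)
  \<comment> \<open>adding an even multiple of \<open>q E\<^sub>3^12\<close> turns the coefficient -27 into -1\<close>
  have "[cube_norm_part * ?N ^ 3 \<simeq> (jacobi_part ^ 3 - 27 * fps_X * ?N ^ 9) * ?N ^ 3 + 2 * (13 * fps_X * ?N ^ 12)] (modulo 2)"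
    unfolding cube_norm_part_def by (rule rcong_add_multiple)
  also have "(jacobi_part ^ 3 - 27 * fps_X * ?N ^ 9) * ?N ^ 3 + 2 * (13 * fps_X * ?N ^ 12) =
      jacobi_part ^ 3 * ?N ^ 3 - fps_X * ?N ^ 12"
    by (simp add: algebra_simps flip: power_add)
  also have "[\<dots> \<simeq> euler ^ 3 * ?N ^ 3 - fps_X * dil 12 euler ^ 3] (modulo 2)"
    by (intro rcong_diff rcong_mult rcong_power rcong_refl jacobi_part_rcong N)
  also have "[\<dots> \<simeq> dil 4 (euler ^ 3) + fps_X * dil 12 (euler ^ 3) - fps_X * dil 12 euler ^ 3] (modulo 2)"
    by (rule rcong_diff[OF euler_cubes_rcong_2 rcong_refl])
  also have "dil 4 (euler ^ 3) + fps_X * dil 12 (euler ^ 3) - fps_X * dil 12 euler ^ 3 = dil 4 euler ^ 3"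
    by simp
  finally show ?thesis .
qed

text \<open>
  The odd part is \<open>E\<^sub>3^3 / E^3\<close>.  Its exponents congruent to 1 modulo 3 come from the middle term of
  the cofactor of \<open>E^3\<close>, and after division by the norm the result is a series in \<open>q^2\<close>
  modulo 2.
\<close>
theorem p33_even_12n_9: "2 dvd p33_fps $ (12 * n + 9)"
proof -
  let ?p = "sec 3 1 (sec 2 1 p33_fps)" and ?N = "dil 3 euler"
  let ?c = "dil 3 (jacobi_part ^ 2) + fps_X * dil 3 (3 * jacobi_part * dil 3 euler ^ 3) +
      fps_X * (fps_X * dil 3 (9 * dil 3 euler ^ 6))"
  have "[sec 2 1 p33_fps * euler ^ 3 * ?c \<simeq> ?N ^ 3 * ?c] (modulo 2)"
    by (rule rcong_mult[OF even_odd_parts_rcong_2(2) rcong_refl])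
  then have "[sec 2 1 p33_fps * dil 3 cube_norm_part \<simeq> dil 3 (euler ^ 3) * ?c] (modulo 2)"
    unfolding euler_cube_inverse[symmetric] by (simp add: mult.assoc)
  then have "[sec 3 1 (sec 2 1 p33_fps * dil 3 cube_norm_part) \<simeq> sec 3 1 (dil 3 (euler ^ 3) * ?c)] (modulo 2)"
    by (rule rcong_sec)
  then have "[?p * cube_norm_part \<simeq> euler ^ 3 * (3 * jacobi_part * ?N ^ 3)] (modulo 2)"
    by (simp add: sec_mult_dil sec_dil_mult sec_simps sec_X_mult sec_X del: dil_mult dil_power)
  then have "[?p * cube_norm_part * ?N ^ 3 \<simeq> euler ^ 3 * (3 * jacobi_part * ?N ^ 3) * ?N ^ 3] (modulo 2)"
    by (rule rcong_mult[OF _ rcong_refl])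
  also have "[euler ^ 3 * (3 * jacobi_part * ?N ^ 3) * ?N ^ 3 \<simeq> euler ^ 3 * (1 * euler * ?N ^ 3) * ?N ^ 3] (modulo 2)"
    by (intro rcong_mult rcong_refl jacobi_part_rcong) (simp add: rcong_def)
  also have "euler ^ 3 * (1 * euler * ?N ^ 3) * ?N ^ 3 = (euler ^ 2 * ?N ^ 3) ^ 2"
    by (simp add: power_mult_distrib mult_ac flip: power_mult power_add power_Suc)
  also have "[\<dots> \<simeq> dil 2 (euler ^ 2 * ?N ^ 3)] (modulo 2)"
    by (rule fps_small_prime_power_rcong)
  finally have "[?p * (cube_norm_part * ?N ^ 3) \<simeq> dil 2 (euler ^ 2 * ?N ^ 3)] (modulo 2)"
    by (simp only: mult.assoc)
  moreover have "[?p * dil 2 (dil 2 euler ^ 3) \<simeq> ?p * (cube_norm_part * ?N ^ 3)] (modulo 2)"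
    using rcong_mult[OF rcong_refl rcong_sym[OF cube_norm_part_rcong_2]] by simp
  ultimately have "[?p * dil 2 (dil 2 euler ^ 3) \<simeq> dil 2 (euler ^ 2 * ?N ^ 3)] (modulo 2)"
    using rcong_trans by blast
  then have "[sec 2 1 (?p * dil 2 (dil 2 euler ^ 3)) \<simeq> sec 2 1 (dil 2 (euler ^ 2 * ?N ^ 3))] (modulo 2)"
    by (rule rcong_sec)
  then have "[sec 2 1 ?p * dil 2 euler ^ 3 \<simeq> 0 * dil 2 euler ^ 3] (modulo 2)"
    by (simp add: sec_mult_dil del: dil_mult dil_power)
  then have "[sec 2 1 ?p \<simeq> 0] (modulo 2)"
    by (rule rcong_cancel_unit) (intro unit_intros)
  then have "[sec 12 9 p33_fps \<simeq> 0] (modulo 2)"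
    by (simp add: sec_sec)
  then show ?thesis
    by (rule rcong_0_coeff)
qed

section \<open>The congruence modulo 4\<close>

lemma rcong_fneg_numeral:
  "[f \<simeq> g] (modulo (numeral c)) \<Longrightarrow> [fneg f \<simeq> fneg g] (modulo (numeral c))"
  unfolding rcong_fps_iff by (simp flip: right_diff_distrib)

lemma fneg_dil_odd: "odd k \<Longrightarrow> fneg (dil k f) = dil k (fneg f)"
proof (rule fps_ext)
  fix n assume k: "odd k"
  then have k': "k > 0" by (rule odd_pos)
  show "fneg (dil k f) $ n = dil k (fneg f) $ n"
  proof (cases "k dvd n")
    case True
    then obtain m where "n = k * m" by (rule dvdE)
    then show ?thesis using k k' by (simp add: dil_nth power_mult)
  qed (use k' in \<open>simp add: dil_nth\<close>)
qed

text \<open>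
  Multiplying numerator and denominator of \<open>1 / F\<close> by \<open>F(-q)\<close> makes the denominator even: by
  \<open>euler_fneg\<close> it is a product of Euler products at even powers of \<open>q\<close>.  Since the 2-dissection of \<open>F\<close> is known modulo 4,
  so is the even part of \<open>1 / F\<close>.  Replacing \<open>E^4\<close> by \<open>E\<^sub>2^2\<close>, this part becomes \<open>E^3\<close> times a series in
  \<open>q^3\<close>, and \<open>E^3\<close> has no exponents congruent to 2 modulo 3.
\<close>
theorem p33_mod_4: "4 dvd p33_fps $ (6 * n + 4)"
proof -
  define F where "F = euler ^ 3 * dil 3 euler ^ 3"
  define M where "M = dil 3 phi * dil 2 psi"
  define M' where "M' = phi * dil 6 psi"
  let ?p = "sec 2 0 p33_fps" and ?e = euler and ?e2 = "dil 2 euler" and ?e3 = "dil 3 euler" and ?e6 = "dil 6 euler"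
  have e4: "[?e ^ 4 \<simeq> ?e2 ^ 2] (modulo 4)"
    using rcong_square_4[OF fps_small_prime_power_rcong(1)[of euler]] by (simp flip: power_mult)
  have e4_3: "[?e3 ^ 4 \<simeq> ?e6 ^ 2] (modulo 4)"
    using rcong_dil[OF e4, of 3] by simp
  have "dil 3 (euler * fneg euler * dil 4 euler) = dil 3 (dil 2 euler ^ 3)"
    unfolding euler_fneg ..
  then have e3_fneg: "dil 3 euler * fneg (dil 3 euler) * dil 12 euler = dil 6 euler ^ 3"
    by (simp add: fneg_dil_odd)
  have "F * fneg F * (dil 4 euler * dil 12 euler) ^ 3 =
      (euler * fneg euler * dil 4 euler) ^ 3 * (dil 3 euler * fneg (dil 3 euler) * dil 12 euler) ^ 3"
    by (simp add: F_def power_mult_distrib mult_ac)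
  also have "\<dots> = dil 2 ((?e * ?e3) ^ 9)"
    unfolding euler_fneg e3_fneg by (simp add: power_mult_distrib flip: power_mult)
  finally have norm: "F * fneg F * (dil 4 euler * dil 12 euler) ^ 3 = dil 2 ((?e * ?e3) ^ 9)" .
  have "p33_fps * F = 1"
    using p33_fps_euler by (simp add: F_def)
  then have "p33_fps * dil 2 ((?e * ?e3) ^ 9) = fneg F * dil 2 ((?e2 * ?e6) ^ 3)"
    unfolding norm[symmetric] by (simp flip: mult.assoc)
  also have "[\<dots> \<simeq> (dil 2 M - fps_X * dil 2 M') * dil 2 ((?e2 * ?e6) ^ 3)] (modulo 4)"
    using rcong_fneg_numeral[OF euler_cubes_rcong_4]
    by (intro rcong_mult rcong_refl) (simp add: F_def M_def M'_def fneg_dil_even)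
  also have "(dil 2 M - fps_X * dil 2 M') * dil 2 ((?e2 * ?e6) ^ 3) =
      dil 2 (M * (?e2 * ?e6) ^ 3) - fps_X * dil 2 (M' * (?e2 * ?e6) ^ 3)"
    by (simp add: algebra_simps)
  finally have "[sec 2 0 (p33_fps * dil 2 ((?e * ?e3) ^ 9)) \<simeq>
      sec 2 0 (dil 2 (M * (?e2 * ?e6) ^ 3) - fps_X * dil 2 (M' * (?e2 * ?e6) ^ 3))] (modulo 4)"
    by (rule rcong_sec)
  then have *: "[?p * (?e * ?e3) ^ 9 \<simeq> M * (?e2 * ?e6) ^ 3] (modulo 4)"
    by (simp add: sec_mult_dil sec_simps sec_X_mult sec_X del: dil_mult dil_power)
  have "[?p * (?e * (?e2 ^ 2) ^ 2 * (?e3 * (?e6 ^ 2) ^ 2)) \<simeq>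
      ?p * (?e * (?e ^ 4) ^ 2 * (?e3 * (?e3 ^ 4) ^ 2))] (modulo 4)"
    by (intro rcong_mult rcong_power rcong_refl rcong_sym[OF e4] rcong_sym[OF e4_3])
  also have "?p * (?e * (?e ^ 4) ^ 2 * (?e3 * (?e3 ^ 4) ^ 2)) = ?p * (?e * ?e3) ^ 9"
    by (simp add: power_mult_distrib mult_ac flip: power_mult power_Suc)
  also note *
  also have "[M * (?e2 * ?e6) ^ 3 \<simeq> dil 3 phi * dil 2 (euler ^ 3) * (?e2 * ?e6) ^ 3] (modulo 4)"
    unfolding M_def by (intro rcong_mult rcong_refl rcong_dil rcong_sym[OF euler_cube_rcong_psi]) simp
  finally have "[?p * ?e3 * ?e6 * ?e * (?e2 ^ 4 * ?e6 ^ 3) \<simeq> dil 3 phi * ?e2 ^ 2 * (?e2 ^ 4 * ?e6 ^ 3)] (modulo 4)"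
    by (simp add: power_mult_distrib mult_ac eval_nat_numeral)
  then have "[?p * ?e3 * ?e6 * ?e \<simeq> dil 3 phi * ?e2 ^ 2] (modulo 4)"
    by (rule rcong_cancel_unit) (intro unit_intros)
  also have "[dil 3 phi * ?e2 ^ 2 \<simeq> dil 3 phi * ?e ^ 4] (modulo 4)"
    by (intro rcong_mult rcong_refl rcong_sym[OF e4])
  finally have "[?p * ?e3 * ?e6 * ?e \<simeq> dil 3 phi * ?e ^ 3 * ?e] (modulo 4)"
    by (simp add: eval_nat_numeral mult_ac)
  then have "[?p * ?e3 * ?e6 \<simeq> dil 3 phi * ?e ^ 3] (modulo 4)"
    by (rule rcong_cancel_unit) (intro unit_intros)
  then have "[?p * dil 3 (?e * ?e2) \<simeq> dil 3 phi * ?e ^ 3] (modulo 4)"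
    by (simp add: mult_ac)
  then have "[sec 3 2 (?p * dil 3 (?e * ?e2)) \<simeq> sec 3 2 (dil 3 phi * ?e ^ 3)] (modulo 4)"
    by (rule rcong_sec)
  then have "[sec 3 2 ?p * (?e * ?e2) \<simeq> 0 * (?e * ?e2)] (modulo 4)"
    by (simp add: sec_mult_dil sec_dil_mult sec_euler_cube del: dil_mult dil_power)
  then have "[sec 3 2 ?p \<simeq> 0] (modulo 4)"
    by (rule rcong_cancel_unit) (intro unit_intros)
  then have "[sec 6 4 p33_fps \<simeq> 0] (modulo 4)"
    by (simp add: sec_sec)
  then show ?thesis
    by (rule rcong_0_coeff)
qed

lemma p33_cong_iff: "[p33 m = 0] (mod (numeral c)) \<longleftrightarrow> numeral c dvd p33_fps $ m"
  using int_dvd_int_iff[of "numeral c" "p33 m"] by (simp add: p33_fps_def cong_0_iff)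

theorem theorem1p1:
  fixes n :: nat
  shows "[p33 (12 * n + 6) = 0] (mod 2) \<and> [p33 (12 * n + 9) = 0] (mod 2) \<and>
         [p33 (6 * n + 4) = 0] (mod 4) \<and>
         [p33 (3 * n + 1) = 0] (mod 3) \<and>
         [p33 (3 * n + 2) = 0] (mod 9) \<and>
         [p33 (9 * n + 5) = 0] (mod 27) \<and> [p33 (9 * n + 8) = 0] (mod 27) \<and>
         [p33 (5 * n + 3) = 0] (mod 5)"
  unfolding p33_cong_iff
  using p33_even_12n_6 p33_even_12n_9 p33_mod_4 p33_mod_3 p33_mod_9 p33_mod_27[of 1] p33_mod_27[of 2] p33_mod_5
  by simp

end
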